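(* A graph $G$ has exactly three distinct power domination roots if and only if $G$ is isomorphic to $G_1\,\dot\cup\cdots\dot\cup\, G_k\,\dot\cup\,\overline{K_r}$ for some $k\ge 1$, $r\ge 0$, with $G_i\in\mathscr{F}$ for $1\le i\le k$. Moreover, if $G$ has exactly three distinct power domination roots, these roots are $0$, $\frac{-3+\sqrt3\, i}{2}$, and $\frac{-3-\sqrt3\, i}{2}$.
   Context: Graphs are finite and simple with nonempty vertex set; $\overline{K_r}$ is the edgeless graph on $r$ vertices (empty if $r=0$), $\dot\cup$ is disjoint union. $\mathscr{F}$ is the family of graphs obtained from a connected graph $H$ by adding, for each vertex $v$ of $H$, two new vertices $v',v''$, the two new edges $vv'$ and $vv''$, and possibly the edge $v'v''$. For $S\subseteq V(G)$, $S$ is a power dominating set if, after coloring $S$, coloring every neighbor of a vertex of $S$, and then repeatedly applying the forcing rule (a colored vertex with exactly one uncolored neighbor colors that neighbor) until no changes occur, all vertices are colored. $\mathcal{P}(G;x)=\sum_{i=1}^{|V(G)|}p(G;i)x^i$, where $p(G;i)$ is the number of power dominating sets of size $i$; a power domination root of $G$ is a complex root of $\mathcal{P}(G;x)$. *)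

theory Defs
  imports
    Complex_Main
    "HOL-Computational_Algebra.Polynomial"
    "Graph_Theory.Graph_Theory"
begin

text \<open>
  Finite simple undirected graphs are the instances of \<^locale>\<open>pair_graph\<close>: an edge \<open>uv\<close> is
  represented by the two arcs \<open>(u, v)\<close> and \<open>(v, u)\<close>. The locale admits the graph without vertices,
  so nonemptiness is a separate hypothesis wherever it is needed.
\<close>

definition nbrs :: "'a pair_pre_digraph \<Rightarrow> 'a \<Rightarrow> 'a set" where
  "nbrs G v = {u. (v, u) \<in> parcs G}"

definition force_step :: "'a pair_pre_digraph \<Rightarrow> 'a set \<Rightarrow> 'a set \<Rightarrow> bool" where
  "force_step G C C' \<longleftrightarrow> (\<exists>v\<in>C. \<exists>w. nbrs G v - C = {w} \<and> C' = insert w C)"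

text \<open>
  No forcing step leaves \<^term>\<open>pverts G\<close>, so reaching it means that the process has stopped with
  every vertex colored.
\<close>

definition power_dominating :: "'a pair_pre_digraph \<Rightarrow> 'a set \<Rightarrow> bool" where
  "power_dominating G S \<longleftrightarrow>
     S \<subseteq> pverts G \<and> (force_step G)\<^sup>*\<^sup>* (S \<union> (\<Union>v\<in>S. nbrs G v)) (pverts G)"

definition num_power_dominating :: "'a pair_pre_digraph \<Rightarrow> nat \<Rightarrow> nat" where
  "num_power_dominating G i = card {S. power_dominating G S \<and> card S = i}"

definition power_domination_poly :: "'a pair_pre_digraph \<Rightarrow> complex poly" where
  "power_domination_poly G =
     (\<Sum>i = 1..card (pverts G). monom (of_nat (num_power_dominating G i)) i)"

definition power_domination_roots :: "'a pair_pre_digraph \<Rightarrow> complex set" where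
  "power_domination_roots G = {z. poly (power_domination_poly G) z = 0}"

text \<open>
  In the following family, \<open>p v\<close> and \<open>q v\<close> are the new vertices \<open>v'\<close> and \<open>v''\<close>, and \<open>T\<close> is the set
  of those \<open>v\<close> for which the optional edge \<open>v'v''\<close> is present.
\<close>

definition family_F :: "'a pair_pre_digraph set" where
  "family_F = {G. \<exists>H p q T.
     pair_graph H \<and> Digraph_Component.connected (with_proj H) \<and>
     inj_on p (pverts H) \<and> inj_on q (pverts H) \<and>
     p ` pverts H \<inter> q ` pverts H = {} \<and>
     (p ` pverts H \<union> q ` pverts H) \<inter> pverts H = {} \<and>
     T \<subseteq> pverts H \<and>
     G = \<lparr> pverts = pverts H \<union> p ` pverts H \<union> q ` pverts H,
           parcs = parcs H
             \<union> (\<Union>v\<in>pverts H. {(v, p v), (p v, v), (v, q v), (q v, v)})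
             \<union> (\<Union>v\<in>T. {(p v, q v), (q v, p v)}) \<rparr>}"

definition edgeless :: "nat \<Rightarrow> nat pair_pre_digraph" where
  "edgeless r = \<lparr> pverts = {..<r}, parcs = {} \<rparr>"

definition disj_union ::
    "'a pair_pre_digraph \<Rightarrow> 'b pair_pre_digraph \<Rightarrow> ('a + 'b) pair_pre_digraph" where
  "disj_union G H = \<lparr> pverts = pverts G <+> pverts H,
     parcs = {(Inl u, Inl v) | u v. (u, v) \<in> parcs G} \<union> {(Inr u, Inr v) | u v. (u, v) \<in> parcs H} \<rparr>"

definition disj_Union ::
    "'i set \<Rightarrow> ('i \<Rightarrow> 'a pair_pre_digraph) \<Rightarrow> ('i \<times> 'a) pair_pre_digraph" where
  "disj_Union I Gs = \<lparr> pverts = (SIGMA i:I. pverts (Gs i)),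
     parcs = {((i, u), (i, v)) | i u v. i \<in> I \<and> (u, v) \<in> parcs (Gs i)} \<rparr>"

end

theory Submission
  imports Defs "HOL-Computational_Algebra.Fundamental_Theorem_Algebra"
begin

text \<open>
  The polynomial is multiplicative over disjoint unions, and components with at most two vertices
  contribute only the roots 0 and -2. Let \<open>n > 0\<close> be the number of vertices in the larger components.
  Complements of sets of at most two of these vertices are power dominating, so the three top
  coefficients of their polynomial are those of \<open>(1 + x)\<^sup>n\<close>; hence its roots have sum \<open>-n\<close> and sum of
  squares \<open>n\<close>. If all were real, Cauchy-Schwarz would force all \<open>n\<close> of them to be nonzero, but 0 is
  a root. So the nonzero roots are conjugate, and the polynomial is \<open>x\<^sup>m (x\<^sup>2 + p x + q)\<^sup>j\<close> with
  \<open>p = n / j\<close> and \<open>q = p (p - 1) / 2\<close>. Some minimum power dominating set gives each of its vertices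
  two private neighbours, so \<open>3 m \<le> n = m + 2 j\<close> and \<open>2 < p \<le> 3\<close>; integrality of \<open>q\<^sup>j\<close> gives
  \<open>p = q = 3\<close> and \<open>n = 3 m\<close>.

  The next coefficient shows that exactly \<open>m\<close> triples have a complement that is not power
  dominating. Every such triple is a vertex with two private leaves \<open>v'\<close>, \<open>v''\<close> as in the family, and it
  coincides with one of the \<open>m\<close> blocks formed by a vertex of the minimum set and its private
  neighbours. As there are equally many of both, these triples partition the vertices.
\<close>

subsection \<open>Polynomials with three distinct roots\<close>

lemma coeff_mult_upto_2:
  fixes p q :: "'a::comm_ring_1 poly"
  shows "coeff (p * q) 0 = coeff p 0 * coeff q 0"
    and "coeff (p * q) 1 = coeff p 0 * coeff q 1 + coeff p 1 * coeff q 0"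
    and "coeff (p * q) 2 = coeff p 0 * coeff q 2 + coeff p 1 * coeff q 1 + coeff p 2 * coeff q 0"
  by (simp_all add: coeff_mult numeral_2_eq_2)

lemma coeff_quad:
  "coeff [:u, v, w:] 0 = u" "coeff [:u, v, w:] 1 = v" "coeff [:u, v, w:] 2 = w"
  by (simp_all add: numeral_2_eq_2)

text \<open>Newton's identities for \<open>j\<close> copies of \<open>a\<close> and \<open>l\<close>
  copies of \<open>b\<close>. The power sums after the first are eliminated through
  \<open>a + b\<close> and \<open>a * b\<close>, so consecutive coefficients determine one
  another.\<close>

lemma newton_identities_two_roots:
  fixes a b :: complex and j l :: nat
  defines "R \<equiv> [:1, - a:] ^ j * [:1, - b:] ^ l"
  shows "coeff R 1 = - (of_nat j * a + of_nat l * b)"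
    and "2 * coeff R 2 - (a + b) * coeff R 1 =
           - (of_nat j * a + of_nat l * b) * coeff R 1 + of_nat (j + l) * (a * b)"
    and "3 * coeff R 3 - 2 * (a + b) * coeff R 2 + a * b * coeff R 1 =
           - (of_nat j * a + of_nat l * b) * coeff R 2 + of_nat (j + l) * (a * b) * coeff R 1"
proof -
  \<comment> \<open>Compare coefficients in the logarithmic derivative of \<open>R\<close>.\<close>
  have pw: "pderiv ([:1, - c:] ^ k) * [:1, - c:] = smult (- (of_nat k * c)) ([:1, - c:] ^ k)"
    for c :: complex and k
  proof (cases k)
    case (Suc i)
    have "pderiv ([:1, - c:] ^ k) * [:1, - c:] = smult (of_nat k) (pderiv [:1, - c:] * [:1, - c:] ^ k)"
      unfolding pderiv_power Suc by (simp add: mult_ac del: mult_pCons_left mult_pCons_right)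
    also have "pderiv [:1, - c:] = [:- c:]" by (simp add: pderiv_pCons)
    finally show ?thesis by simp
  qed simp
  have "pderiv R * ([:1, - a:] * [:1, - b:]) =
      (pderiv ([:1, - a:] ^ j) * [:1, - a:]) * [:1, - b:] ^ l * [:1, - b:]
      + (pderiv ([:1, - b:] ^ l) * [:1, - b:]) * [:1, - a:] ^ j * [:1, - a:]"
    unfolding R_def pderiv_mult by (simp only: algebra_simps)
  also have "\<dots> = (smult (- (of_nat j * a)) [:1, - b:] + smult (- (of_nat l * b)) [:1, - a:]) * R"
    unfolding pw R_def by (simp only: algebra_simps mult_smult_left mult_smult_right)
  also have "smult (- (of_nat j * a)) [:1, - b:] + smult (- (of_nat l * b)) [:1, - a:] =
      [:- (of_nat j * a + of_nat l * b), of_nat (j + l) * (a * b), 0:]"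
    by (simp add: algebra_simps)
  also have "[:1, - a:] * [:1, - b:] = [:1, - (a + b), a * b:]"
    by (simp add: algebra_simps)
  finally have eq: "pderiv R * [:1, - (a + b), a * b:] =
      [:- (of_nat j * a + of_nat l * b), of_nat (j + l) * (a * b), 0:] * R" .
  have R0: "coeff R 0 = 1"
    unfolding R_def by (simp add: coeff_mult_upto_2 coeff_0_power)
  have d: "coeff (pderiv R) 0 = coeff R 1" "coeff (pderiv R) 1 = 2 * coeff R 2"
    "coeff (pderiv R) 2 = 3 * coeff R 3"
    by (simp_all add: coeff_pderiv numeral_2_eq_2 numeral_3_eq_3)
  from arg_cong[OF eq, of "\<lambda>p. coeff p 0"]
  show "coeff R 1 = - (of_nat j * a + of_nat l * b)"
    unfolding coeff_mult_upto_2 coeff_quad d R0 by simp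
  from arg_cong[OF eq, of "\<lambda>p. coeff p 1"]
  show "2 * coeff R 2 - (a + b) * coeff R 1 =
           - (of_nat j * a + of_nat l * b) * coeff R 1 + of_nat (j + l) * (a * b)"
    unfolding coeff_mult_upto_2 coeff_quad d R0 by (simp add: algebra_simps)
  from arg_cong[OF eq, of "\<lambda>p. coeff p 2"]
  show "3 * coeff R 3 - 2 * (a + b) * coeff R 2 + a * b * coeff R 1 =
           - (of_nat j * a + of_nat l * b) * coeff R 2 + of_nat (j + l) * (a * b) * coeff R 1"
    unfolding coeff_mult_upto_2 coeff_quad d R0 by (simp add: algebra_simps)
qed

text \<open>Only containment of the root set is assumed, so an order may be zero; a value that is no
  root then contributes the factor 1.\<close>

lemma complex_poly_three_roots:
  fixes P :: "complex poly"
  assumes "lead_coeff P = 1" and sub: "{z. poly P z = 0} \<subseteq> {0, a, b}"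
    and "a \<noteq> 0" "b \<noteq> 0" "a \<noteq> b"
  shows "P = [:0, 1:] ^ order 0 P * [:- a, 1:] ^ order a P * [:- b, 1:] ^ order b P"
proof -
  have "P \<noteq> 0" using assms(1) by auto
  have "P = (\<Prod>z | poly P z = 0. [:- z, 1:] ^ order z P)"
    using complex_poly_decompose[of P] assms(1) by simp
  also have "\<dots> = (\<Prod>z\<in>{0, a, b}. [:- z, 1:] ^ order z P)"
    using sub by (intro prod.mono_neutral_left) (auto simp: order_root \<open>P \<noteq> 0\<close>)
  also have "\<dots> = [:0, 1:] ^ order 0 P * [:- a, 1:] ^ order a P * [:- b, 1:] ^ order b P"
    using assms(3-5) by (simp add: mult.assoc)
  finally show ?thesis .
qed

lemma poly_root_cnj:
  fixes P :: "complex poly"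
  assumes "\<And>i. coeff P i \<in> \<int>" "poly P z = 0"
  shows "poly P (cnj z) = 0"
proof -
  have "cnj (coeff P i) = coeff P i" for i
    using assms(1)[of i] by (auto elim: Ints_cases)
  hence "poly P (cnj z) = cnj (poly P z)"
    by (simp add: poly_altdef)
  with assms(2) show ?thesis by simp
qed

text \<open>Cauchy-Schwarz for \<open>j\<close> copies of \<open>a\<close> and \<open>l\<close>
  copies of \<open>b\<close> gives \<open>n * n \<le> (j + l) * n\<close>; the term with
  \<open>a - b\<close> in the proof is the defect from Lagrange's identity.\<close>

lemma reals_two_values_bound:
  fixes a b :: real and n j l :: nat
  assumes "real j * a + real l * b = - real n" "real j * a\<^sup>2 + real l * b\<^sup>2 = real n"
    and "0 < n"
  shows "n \<le> j + l"
proof -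
  have "(real j * a + real l * b)\<^sup>2 + real j * real l * (a - b)\<^sup>2 = (real j + real l) * (real j * a\<^sup>2 + real l * b\<^sup>2)"
    by (simp add: power2_eq_square algebra_simps)
  moreover have "0 \<le> real j * real l * (a - b)\<^sup>2" by simp
  ultimately have "real n * real n \<le> real (j + l) * real n"
    unfolding assms(1,2) unfolding power2_minus power2_eq_square of_nat_add by linarith
  thus ?thesis using \<open>0 < n\<close> by simp
qed

text \<open>The rational \<open>q\<close> is a root of the monic integer polynomial x^j - q^j, hence
  an integer. Then \<open>p\<close> is a root of x^2 - x - 2q and is an integer too, and 3 is the
  only one in the interval.\<close>

lemma rational_quadratic_int:
  fixes p q :: real
  assumes "p \<in> \<rat>" "2 < p" "p \<le> 3" "2 * q = p * (p - 1)" "q ^ j \<in> \<int>" "0 < j"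
  shows "p = 3"
proof -
  have "q = p * (p - 1) / 2" using assms(4) by simp
  hence "q \<in> \<rat>" using assms(1) by (simp only: Rats_divide Rats_mult Rats_diff Rats_1 Rats_number_of)
  have "algebraic_int q"
    by (rule algebraic_int_root[of "q ^ j" "monom 1 j"])
       (use assms in \<open>auto simp: poly_monom degree_monom_eq int_imp_algebraic_int\<close>)
  with \<open>q \<in> \<rat>\<close> have "q \<in> \<int>" by (intro rational_algebraic_int_is_int)
  hence "algebraic_int (2 * q)" by (intro int_imp_algebraic_int) auto
  hence "algebraic_int p"
    by (rule algebraic_int_root[of _ "[:0, -1, 1:]"])
       (use assms(4) in \<open>auto simp: algebra_simps coeff_pCons split: nat.splits\<close>)
  with assms(1) have "p \<in> \<int>" by (intro rational_algebraic_int_is_int)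
  then obtain k :: int where "p = of_int k" by (auto elim: Ints_cases)
  with assms(2,3) show ?thesis by (simp; linarith)
qed

lemma coeff_reflect_poly_low: "i \<le> degree p \<Longrightarrow> coeff (reflect_poly p) i = coeff p (degree p - i)"
  by (simp add: coeff_reflect_poly)

text \<open>In the application \<open>g\<close> counts the triples whose complement is not power
  dominating, and \<open>k\<close> is the size of a power dominating set. The coefficients below the
  leading one yield in turn the sum of the roots, the sum of their squares and the value of
  \<open>g\<close>.\<close>

lemma three_roots_rigidity:
  fixes P :: "complex poly" and n k g :: nat
  assumes deg: "degree P = n" and ints: "\<And>i. coeff P i \<in> \<int>"
    and top: "coeff P n = 1" "coeff P (n - 1) = of_nat n" "coeff P (n - 2) = of_nat (n choose 2)"
      "coeff P (n - 3) = of_nat (n choose 3) - of_nat g"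
    and P0: "poly P 0 = 0" and k: "coeff P k \<noteq> 0" "3 * k \<le> n"
    and sub: "{z. poly P z = 0} \<subseteq> {0, a, b}" and ab: "a \<noteq> 0" "b \<noteq> 0" "a \<noteq> b"
  shows "n = 3 * k \<and> g = k \<and> a \<notin> \<real> \<and> b \<notin> \<real>"
proof -
  have "P \<noteq> 0" using k by auto
  define m j l where "m = order 0 P" "j = order a P" "l = order b P"
  have P: "P = [:0, 1:] ^ m * [:- a, 1:] ^ j * [:- b, 1:] ^ l"
    unfolding m_j_l_def by (rule complex_poly_three_roots) (use assms in auto)
  have "0 < m" using P0 \<open>P \<noteq> 0\<close> by (simp add: m_j_l_def order_gt_0_iff)
  have "degree ([:0, 1:] ^ m * [:- a, 1:] ^ j * [:- b, 1:] ^ l) = m + j + l"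
    by (simp add: degree_mult_eq degree_power_eq)
  hence n: "n = m + j + l" using P deg by simp
  have Pm: "P = monom 1 m * ([:- a, 1:] ^ j * [:- b, 1:] ^ l)"
    by (subst P) (simp add: monom_altdef mult.assoc)
  have "m \<le> k"
    using k(1) by (subst (asm) Pm) (auto simp: coeff_monom_mult split: if_splits)
  hence "3 \<le> n" "3 * m \<le> n" using k(2) \<open>0 < m\<close> by linarith+
  \<comment> \<open>Reversal removes the factor x^m and turns the top coefficients of
    \<open>P\<close> into low ones, to which Newton's identities apply.\<close>
  have refl: "reflect_poly P = [:1, - a:] ^ j * [:1, - b:] ^ l"
  proof -
    have "reflect_poly [:c, 1:] = [:1, c:]" for c :: complex
      by (cases "c = 0") (simp_all add: reflect_poly_pCons reflect_poly_pCons')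
    thus ?thesis
      by (subst P) (simp add: reflect_poly_mult reflect_poly_power flip: one_pCons)
  qed
  define R where "R = reflect_poly P"
  have R: "coeff R 1 = of_nat n" "coeff R 2 = of_nat (n choose 2)"
    "coeff R 3 = of_nat (n choose 3) - of_nat g"
    using \<open>3 \<le> n\<close> top by (simp_all add: R_def coeff_reflect_poly_low deg)
  note N = newton_identities_two_roots[of a j b l, folded refl, folded R_def, unfolded R]
  have c2: "2 * complex_of_nat (n choose 2) = of_nat n * (of_nat n - 1)"
    by (simp add: binomial_gbinomial gbinomial_prod_rev numeral_2_eq_2)
  have c3: "6 * complex_of_nat (n choose 3) = of_nat n * (of_nat n - 1) * (of_nat n - 2)"
    by (simp add: binomial_gbinomial gbinomial_prod_rev numeral_3_eq_3)
  have s1: "of_nat j * a + of_nat l * b = - complex_of_nat n" using N(1) by (metis minus_minus)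
  have q1: "of_nat (j + l) * (a * b) = - of_nat n * (1 + (a + b))"
    using N(2) unfolding s1 c2 by algebra
  have s2: "of_nat j * a\<^sup>2 + of_nat l * b\<^sup>2 = complex_of_nat n"
  proof -
    have "of_nat j * a\<^sup>2 + of_nat l * b\<^sup>2 =
        (of_nat j * a + of_nat l * b) * (a + b) - of_nat (j + l) * (a * b)"
      by (simp add: power2_eq_square algebra_simps)
    thus ?thesis unfolding s1 q1 by (simp add: algebra_simps)
  qed
  have jpos: "0 < j \<longleftrightarrow> poly P a = 0" and lpos: "0 < l \<longleftrightarrow> poly P b = 0"
    using \<open>P \<noteq> 0\<close> by (simp_all add: m_j_l_def order_root)
  have r1: "real j * Re a + real l * Re b = - real n"
    using arg_cong[OF s1, of Re] by simp
  have i1: "real j * Im a + real l * Im b = 0"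
    using arg_cong[OF s1, of Im] by simp
  have r2: "real j * ((Re a)\<^sup>2 - (Im a)\<^sup>2) + real l * ((Re b)\<^sup>2 - (Im b)\<^sup>2) = real n"
    using arg_cong[OF s2, of Re] by (simp add: power2_eq_square)
  \<comment> \<open>If all roots were real, \<open>reals_two_values_bound\<close> would give n \<le>
    j + l, against n = m + j + l with m > 0. The alternatives \<open>j = 0\<close> and
    \<open>l = 0\<close> cover values that are no roots.\<close>
  have "\<not> ((j = 0 \<or> Im a = 0) \<and> (l = 0 \<or> Im b = 0))"
  proof
    assume "(j = 0 \<or> Im a = 0) \<and> (l = 0 \<or> Im b = 0)"
    hence "real j * (Im a)\<^sup>2 = 0" "real l * (Im b)\<^sup>2 = 0" by auto
    hence "real j * (Re a)\<^sup>2 + real l * (Re b)\<^sup>2 = real n"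
      using r2 unfolding right_diff_distrib by linarith
    from reals_two_values_bound[OF r1 this] \<open>3 \<le> n\<close> n \<open>0 < m\<close> show False by simp
  qed
  hence nonreal: "poly P a = 0 \<and> Im a \<noteq> 0 \<or> poly P b = 0 \<and> Im b \<noteq> 0"
    using jpos lpos by blast
  have ne: "cnj z \<noteq> z" if "Im z \<noteq> 0" for z using that by (simp add: complex_eq_iff)
  \<comment> \<open>The conjugate of a nonreal root is a nonzero root different from it, so it is
    the other of the two values.\<close>
  have "b = cnj a \<and> Im a \<noteq> 0"
    using nonreal
  proof
    assume a: "poly P a = 0 \<and> Im a \<noteq> 0"
    hence "cnj a \<in> {0, a, b}" using poly_root_cnj[OF ints] sub by blast
    thus ?thesis using a ne[of a] ab by auto
  next
    assume b: "poly P b = 0 \<and> Im b \<noteq> 0"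
    hence "cnj b \<in> {0, a, b}" using poly_root_cnj[OF ints] sub by blast
    hence "a = cnj b" using b ne[of b] ab by auto
    thus ?thesis using b by simp
  qed
  hence cnj: "b = cnj a" and Im: "Im a \<noteq> 0" by blast+
  \<comment> \<open>The sum of the roots is real while the imaginary parts of \<open>a\<close> and
    \<open>b\<close> are opposite and nonzero.\<close>
  have "j = l" using i1 Im cnj by simp
  define p where "p = - 2 * Re a"
  define q where "q = (cmod a)\<^sup>2"
  have sum: "a + b = - of_real p" unfolding cnj p_def by (simp add: complex_eq_iff)
  have prod: "a * b = of_real q" unfolding cnj q_def by (simp add: complex_mult_cnj cmod_power2)
  have jp: "real j * p = real n" using r1 cnj \<open>j = l\<close> by (simp add: p_def algebra_simps)
  hence "0 < j" using \<open>3 \<le> n\<close> by (cases "j = 0") auto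
  have p: "p = real n / real j" using jp \<open>0 < j\<close> by (simp add: field_simps)
  have n': "n = m + 2 * j" using n \<open>j = l\<close> by simp
  \<comment> \<open>Here p - 2 = m / j, and 3m \<le> n = m + 2j amounts to m \<le> j.\<close>
  have "2 < p" "p \<le> 3" unfolding p using n' \<open>0 < m\<close> \<open>0 < j\<close> \<open>3 * m \<le> n\<close>
    by (auto simp: field_simps)
  have q2: "2 * real j * q = real n * (p - 1)"
    using q1 unfolding sum prod \<open>j = l\<close>[symmetric] 
    by (simp add: complex_eq_iff algebra_simps)
  have pq: "2 * q = p * (p - 1)"
  proof -
    have "real j * (2 * q) = real j * (p * (p - 1))"
      using q2 unfolding jp[symmetric] by (simp only: mult_ac)
    thus ?thesis using \<open>0 < j\<close> by simp
  qed
  \<comment> \<open>The lowest nonzero coefficient is the product of the nonzero roots up to sign;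
    this is where integrality of the coefficients enters for \<open>q\<close>.\<close>
  have "coeff P m = (- a) ^ j * (- b) ^ j"
    by (subst Pm) (simp add: coeff_monom_mult coeff_mult_upto_2 coeff_0_power \<open>j = l\<close>[symmetric])
  also have "\<dots> = (a * b) ^ j" by (simp flip: power_mult_distrib)
  also have "\<dots> = of_real (q ^ j)" by (simp add: prod)
  finally have "coeff P m = of_real (q ^ j)" .
  hence "complex_of_real (q ^ j) \<in> \<int>" using ints[of m] by simp
  hence "q ^ j \<in> \<int>" by (auto elim!: Ints_cases simp: complex_eq_iff)
  have "p \<in> \<rat>" unfolding p by simp
  have "p = 3"
    by (rule rational_quadratic_int) fact+
  hence "n = 3 * j" using jp by (simp flip: of_nat_mult) 
  hence "m = j" using n' by simp
  have "q = 3" using pq \<open>p = 3\<close> by simp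
  have "g = j"
  proof -
    have "3 * complex_of_nat g = of_nat n"
    proof -
      \<comment> \<open>This is the third Newton identity with p = q = 3. Once the binomial
        coefficients are expanded, all that remains is 3g = n.\<close>
      have "3 * (of_nat (n choose 3) - of_nat g) + 6 * of_nat (n choose 2) + 3 * complex_of_nat n =
          of_nat n * of_nat (n choose 2) + 2 * of_nat n * of_nat n"
        using N(3) unfolding s1 q1 unfolding sum prod \<open>p = 3\<close> \<open>q = 3\<close> by simp
      with c2 c3 show ?thesis by algebra
    qed
    hence "complex_of_nat (3 * g) = of_nat (3 * j)" using \<open>n = 3 * j\<close> by simp
    thus ?thesis by (simp only: of_nat_eq_iff)
  qed
  have "k = j" using \<open>m \<le> k\<close> k(2) \<open>n = 3 * j\<close> \<open>m = j\<close> by simp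
  show ?thesis
    using \<open>n = 3 * j\<close> \<open>g = j\<close> \<open>k = j\<close> Im cnj by (auto simp: complex_is_Real_iff)
qed

subsection \<open>Power dominating sets as hitting sets\<close>

text \<open>Forts are the obstructions known from zero forcing. The graph is given as a vertex set
  and a neighbourhood function, so that passing to a union of components changes only
  \<open>V\<close>.\<close>

definition fort :: "'a set \<Rightarrow> ('a \<Rightarrow> 'a set) \<Rightarrow> 'a set \<Rightarrow> bool" where
  "fort V N U \<longleftrightarrow> U \<subseteq> V \<and> U \<noteq> {} \<and> (\<forall>v\<in>V - U. card (N v \<inter> U) \<noteq> 1)"

definition closed_nbhd :: "('a \<Rightarrow> 'a set) \<Rightarrow> 'a set \<Rightarrow> 'a set" where
  "closed_nbhd N U = U \<union> (\<Union>v\<in>U. N v)"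

text \<open>
  The uncolored vertices left when forcing stops form a fort, so a set is power dominating iff it meets the
  closed neighbourhood of every fort. Power dominating sets are thereby described as hitting sets.
\<close>

definition pds :: "'a set \<Rightarrow> ('a \<Rightarrow> 'a set) \<Rightarrow> 'a set \<Rightarrow> bool" where
  "pds V N S \<longleftrightarrow> S \<subseteq> V \<and> (\<forall>U. fort V N U \<longrightarrow> S \<inter> closed_nbhd N U \<noteq> {})"

text \<open>The constant term is kept, so the empty graph has polynomial 1 and products over parts
  need no exception for empty parts.\<close>

definition pds_poly :: "'a set \<Rightarrow> ('a \<Rightarrow> 'a set) \<Rightarrow> complex poly" where
  "pds_poly V N = (\<Sum>S | pds V N S. monom 1 (card S))"

lemma pds_subset: "pds V N S \<Longrightarrow> S \<subseteq> V"
  unfolding pds_def by blast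

lemma pds_univ: "pds V N V"
  unfolding pds_def fort_def closed_nbhd_def by blast

lemma finite_pds: "finite V \<Longrightarrow> finite {S. pds V N S}"
  by (rule finite_subset[of _ "Pow V"]) (auto simp: pds_def)

lemma not_pdsE:
  assumes "\<not> pds V N S" "S \<subseteq> V"
  obtains U where "fort V N U" "S \<inter> closed_nbhd N U = {}"
  using assms unfolding pds_def by blast

lemma coeff_pds_poly:
  assumes "finite V"
  shows "coeff (pds_poly V N) i = of_nat (card {S. pds V N S \<and> card S = i})"
proof -
  have "coeff (pds_poly V N) i = (\<Sum>S | pds V N S. if card S = i then 1 else 0)"
    unfolding pds_poly_def by (simp add: coeff_sum)
  also have "\<dots> = of_nat (card {S \<in> {S. pds V N S}. card S = i})"
    using finite_pds[OF assms] by (subst sum.inter_filter[symmetric]) auto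
  finally show ?thesis by simp
qed

text \<open>Independent choices on disjoint ground sets: \<open>S\<close> corresponds to the pair of
  its traces, and cardinalities add.\<close>

lemma sum_monom_card_union:
  assumes "finite A" "finite B" "A \<inter> B = {}" "F \<subseteq> Pow A" "G \<subseteq> Pow B"
  shows "(\<Sum>S | S \<subseteq> A \<union> B \<and> S \<inter> A \<in> F \<and> S \<inter> B \<in> G. monom (1::complex) (card S)) =
    (\<Sum>S\<in>F. monom 1 (card S)) * (\<Sum>T\<in>G. monom 1 (card T))"
proof -
  have "(\<Sum>S | S \<subseteq> A \<union> B \<and> S \<inter> A \<in> F \<and> S \<inter> B \<in> G. monom (1::complex) (card S)) =
    (\<Sum>(S, T)\<in>F \<times> G. monom 1 (card S) * monom 1 (card T))"
  proof (rule sum.reindex_bij_witness[of _ "\<lambda>(S, T). S \<union> T" "\<lambda>S. (S \<inter> A, S \<inter> B)"])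
    fix S assume "S \<in> {S. S \<subseteq> A \<union> B \<and> S \<inter> A \<in> F \<and> S \<inter> B \<in> G}"
    hence "S = (S \<inter> A) \<union> (S \<inter> B)" by blast
    hence "card S = card ((S \<inter> A) \<union> (S \<inter> B))" by simp
    also have "\<dots> = card (S \<inter> A) + card (S \<inter> B)"
      using assms by (intro card_Un_disjoint) auto
    finally show "(case (S \<inter> A, S \<inter> B) of (S, T) \<Rightarrow> monom (1::complex) (card S) * monom 1 (card T)) =
        monom 1 (card S)"
      by (simp add: mult_monom)
  next
    fix x assume x: "x \<in> F \<times> G"
    obtain S T where [simp]: "x = (S, T)" by fastforce
    have ST: "S \<in> F" "T \<in> G" "S \<subseteq> A" "T \<subseteq> B" using x assms by auto
    have "(S \<union> T) \<inter> A = S" "(S \<union> T) \<inter> B = T" using ST assms(3) by blast+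
    thus "((case x of (S, T) \<Rightarrow> S \<union> T) \<inter> A, (case x of (S, T) \<Rightarrow> S \<union> T) \<inter> B) = x"
      and "(case x of (S, T) \<Rightarrow> S \<union> T) \<in> {S. S \<subseteq> A \<union> B \<and> S \<inter> A \<in> F \<and> S \<inter> B \<in> G}"
      using ST by auto
  qed auto
  thus ?thesis by (simp add: sum_product sum.cartesian_product)
qed

lemma sum_Pow_monom_card:
  assumes "finite A"
  shows "(\<Sum>S\<in>Pow A. monom (1::complex) (card S)) = [:1, 1:] ^ card A"
  using assms
proof (induction A)
  case (insert a A)
  have "(\<Sum>S\<in>Pow (insert a A). monom (1::complex) (card S)) =
      (\<Sum>S | S \<subseteq> {a} \<union> A \<and> S \<inter> {a} \<in> Pow {a} \<and> S \<inter> A \<in> Pow A. monom 1 (card S))"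
    by (intro sum.cong) auto
  also have "\<dots> = (\<Sum>S\<in>Pow {a}. monom 1 (card S)) * (\<Sum>S\<in>Pow A. monom 1 (card S))"
    using insert by (intro sum_monom_card_union) auto
  also have "(\<Sum>S\<in>Pow {a}. monom (1::complex) (card S)) = [:1, 1:]"
    by (simp add: Pow_insert monom_altdef one_pCons)
  finally show ?case using insert by (simp del: mult_pCons_left mult_pCons_right)
qed (simp add: monom_altdef)

definition hitting_sets :: "'a set set \<Rightarrow> 'a set set" where
  "hitting_sets \<B> = {S. S \<subseteq> \<Union>\<B> \<and> (\<forall>B\<in>\<B>. S \<inter> B \<noteq> {})}"

text \<open>The factor of a block enumerates its nonempty subsets, and the choices in disjoint
  blocks are independent.\<close>

lemma sum_hitting_sets:
  assumes "finite \<B>" "\<And>B. B \<in> \<B> \<Longrightarrow> finite B" "disjoint \<B>"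
  shows "(\<Sum>S\<in>hitting_sets \<B>. monom (1::complex) (card S)) = (\<Prod>B\<in>\<B>. [:1, 1:] ^ card B - 1)"
  using assms
proof (induction \<B>)
  case empty
  have "hitting_sets {} = {{} :: 'a set}" by (auto simp: hitting_sets_def)
  thus ?case by (simp add: monom_altdef)
next
  case (insert B \<B>)
  have dj: "disjoint \<B>" using insert.prems(2) by (rule pairwise_subset) auto
  have "B \<inter> B' = {}" if "B' \<in> \<B>" for B'
    using insert.prems(2) insert.hyps(2) that by (metis disjointD insertCI)
  hence dj2: "B \<inter> \<Union>\<B> = {}" by blast
  have "finite B" "finite (\<Union>\<B>)" using insert by auto
  have h: "S \<inter> \<Union>\<B> \<in> hitting_sets \<B> \<longleftrightarrow> (\<forall>B\<in>\<B>. S \<inter> B \<noteq> {})" for S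
    unfolding hitting_sets_def by blast
  have "hitting_sets (insert B \<B>) =
      {S. S \<subseteq> B \<union> \<Union>\<B> \<and> S \<inter> B \<in> Pow B - {{}} \<and> S \<inter> \<Union>\<B> \<in> hitting_sets \<B>}"
    unfolding h by (auto simp: hitting_sets_def)
  hence "(\<Sum>S\<in>hitting_sets (insert B \<B>). monom (1::complex) (card S)) =
      (\<Sum>S\<in>Pow B - {{}}. monom 1 (card S)) * (\<Sum>S\<in>hitting_sets \<B>. monom 1 (card S))"
    using sum_monom_card_union[OF \<open>finite B\<close> \<open>finite (\<Union>\<B>)\<close> dj2, of "Pow B - {{}}" "hitting_sets \<B>"]
    by (auto simp: hitting_sets_def)
  also have "(\<Sum>S\<in>Pow B - {{}}. monom (1::complex) (card S)) = [:1, 1:] ^ card B - 1"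
    using \<open>finite B\<close> by (subst sum_diff1) (auto simp: sum_Pow_monom_card simp flip: one_poly_eq_simps(1))
  finally show ?case using insert dj by simp
qed

text \<open>If the closed neighbourhoods of forts and the blocks refine each other in this way,
  meeting all of the former is the same as meeting all blocks. This serves both for components with
  at most two vertices and for leaf partitions.\<close>

lemma pds_poly_hitting_sets:
  assumes "finite \<B>" "\<And>B. B \<in> \<B> \<Longrightarrow> finite B" "disjoint \<B>" "\<Union>\<B> = V"
    and "\<And>B. B \<in> \<B> \<Longrightarrow> \<exists>U. fort V N U \<and> closed_nbhd N U \<subseteq> B"
    and "\<And>U. fort V N U \<Longrightarrow> \<exists>B\<in>\<B>. B \<subseteq> closed_nbhd N U"
  shows "pds_poly V N = (\<Prod>B\<in>\<B>. [:1, 1:] ^ card B - 1)"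
proof -
  have "pds V N S \<longleftrightarrow> S \<in> hitting_sets \<B>" for S
  proof
    assume S: "pds V N S"
    { fix B assume "B \<in> \<B>"
      then obtain U where "fort V N U" "closed_nbhd N U \<subseteq> B" using assms(5) by blast
      hence "S \<inter> B \<noteq> {}" using S unfolding pds_def by blast }
    thus "S \<in> hitting_sets \<B>" using S assms(4) by (auto simp: hitting_sets_def pds_def)
  next
    assume S: "S \<in> hitting_sets \<B>"
    { fix U assume "fort V N U"
      then obtain B where "B \<in> \<B>" "B \<subseteq> closed_nbhd N U" using assms(6) by blast
      hence "S \<inter> closed_nbhd N U \<noteq> {}" using S unfolding hitting_sets_def by blast }
    thus "pds V N S" using S assms(4) by (auto simp: hitting_sets_def pds_def)
  qed
  hence "{S. pds V N S} = hitting_sets \<B>" by blast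
  thus ?thesis unfolding pds_poly_def by (simp add: sum_hitting_sets assms)
qed

text \<open>
  The vertices \<open>a\<close>, \<open>b\<close> play the roles of \<open>v'\<close>, \<open>v''\<close> for \<open>v = c\<close> in the family; the optional edge
  is left open.
\<close>

definition leaf_pair :: "('a \<Rightarrow> 'a set) \<Rightarrow> 'a \<Rightarrow> 'a \<Rightarrow> 'a \<Rightarrow> bool" where
  "leaf_pair N c a b \<longleftrightarrow> a \<noteq> b \<and> a \<noteq> c \<and> b \<noteq> c \<and> c \<in> N a \<and> c \<in> N b \<and> N a \<subseteq> {b, c} \<and> N b \<subseteq> {a, c}"

section \<open>Disjoint unions, coefficients and private neighbours\<close>

locale nbhd_graph =
  fixes V :: "'a set" and N :: "'a \<Rightarrow> 'a set"
  assumes finite_V: "finite V"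
    and N_subset: "v \<in> V \<Longrightarrow> N v \<subseteq> V"
    and N_sym: "v \<in> V \<Longrightarrow> u \<in> N v \<Longrightarrow> v \<in> N u"
    and N_irrefl: "v \<in> V \<Longrightarrow> v \<notin> N v"
begin

lemma finite_N: "v \<in> V \<Longrightarrow> finite (N v)"
  using N_subset finite_V finite_subset by blast

text \<open>Each nonempty trace of a fort on a part is again a fort, and closed neighbourhoods stay
  within their part. Hence a set is power dominating iff both of its traces are.\<close>

lemma pds_poly_union:
  assumes "V = A \<union> B" "A \<inter> B = {}" "\<And>v. v \<in> A \<Longrightarrow> N v \<subseteq> A" "\<And>v. v \<in> B \<Longrightarrow> N v \<subseteq> B"
  shows "pds_poly V N = pds_poly A N * pds_poly B N"
proof -
  \<comment> \<open>Vertices of \<open>Y\<close> have no neighbours in \<open>X\<close>, so they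
    impose nothing on a subset of \<open>X\<close>. Generic names for the parts allow both orders of
    \<open>A\<close> and \<open>B\<close>.\<close>
  have fort_part: "fort V N U \<longleftrightarrow> fort X N U"
    if "U \<subseteq> X" "V = X \<union> Y" "X \<inter> Y = {}" "\<And>v. v \<in> Y \<Longrightarrow> N v \<subseteq> Y" for U X Y
  proof -
    have "N v \<inter> U = {}" if "v \<in> Y" for v using that \<open>U \<subseteq> X\<close> \<open>X \<inter> Y = {}\<close> \<open>\<And>v. v \<in> Y \<Longrightarrow> N v \<subseteq> Y\<close> by blast
    hence "card (N v \<inter> U) \<noteq> 1" if "v \<in> Y" for v using that by simp
    thus ?thesis using that unfolding fort_def by blast
  qed
  have fort_cut: "fort V N (U \<inter> X)"
    if "fort V N U" "U \<inter> X \<noteq> {}" "V = X \<union> Y" "X \<inter> Y = {}" "\<And>v. v \<in> X \<Longrightarrow> N v \<subseteq> X" "\<And>v. v \<in> Y \<Longrightarrow> N v \<subseteq> Y" for U X Y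
    unfolding fort_def
  proof (intro conjI ballI)
    fix v assume v: "v \<in> V - U \<inter> X"
    show "card (N v \<inter> (U \<inter> X)) \<noteq> 1"
    proof (cases "v \<in> X")
      case True
      hence "N v \<inter> (U \<inter> X) = N v \<inter> U" using that by blast
      thus ?thesis using True v that unfolding fort_def by auto
    next
      case False
      hence "N v \<inter> (U \<inter> X) = {}" using that v by blast
      thus ?thesis by simp
    qed
  qed (use that in \<open>auto simp: fort_def\<close>)
  have cn: "closed_nbhd N (U \<inter> A) \<subseteq> A" "closed_nbhd N (U \<inter> B) \<subseteq> B" for U
    using assms(3,4) unfolding closed_nbhd_def by blast+
  have "pds V N S \<longleftrightarrow> S \<subseteq> A \<union> B \<and> pds A N (S \<inter> A) \<and> pds B N (S \<inter> B)" (is "?L \<longleftrightarrow> ?R") for S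
  proof
    assume S: ?L
    { fix U assume U: "fort A N U"
      hence "U \<subseteq> A" "fort V N U" using fort_part[of U A B] assms by (auto simp: fort_def)
      hence "S \<inter> closed_nbhd N U \<noteq> {}" "closed_nbhd N U \<subseteq> A"
        using S cn(1)[of U] unfolding pds_def by (auto simp: Int_absorb2)
      hence "S \<inter> A \<inter> closed_nbhd N U \<noteq> {}" by blast }
    moreover
    { fix U assume U: "fort B N U"
      hence "U \<subseteq> B" "fort V N U" using fort_part[of U B A] assms by (auto simp: fort_def)
      hence "S \<inter> closed_nbhd N U \<noteq> {}" "closed_nbhd N U \<subseteq> B"
        using S cn(2)[of U] unfolding pds_def by (auto simp: Int_absorb2)
      hence "S \<inter> B \<inter> closed_nbhd N U \<noteq> {}" by blast }
    ultimately show ?R using S assms(1) unfolding pds_def by auto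
  next
    assume S: ?R
    { fix U assume U: "fort V N U"
      have "S \<inter> closed_nbhd N U \<noteq> {}"
      proof (cases "U \<inter> A = {}")
        case False
        have "fort A N (U \<inter> A)"
          using fort_cut[OF U False, of B] fort_part[of "U \<inter> A" A B] assms by auto
        hence "S \<inter> A \<inter> closed_nbhd N (U \<inter> A) \<noteq> {}" using S unfolding pds_def by blast
        thus ?thesis unfolding closed_nbhd_def by blast
      next
        case True
        hence nB: "U \<inter> B \<noteq> {}" using U assms(1) unfolding fort_def by blast
        have "fort B N (U \<inter> B)"
          using fort_cut[OF U nB, of A] fort_part[of "U \<inter> B" B A] assms by auto
        hence "S \<inter> B \<inter> closed_nbhd N (U \<inter> B) \<noteq> {}" using S unfolding pds_def by blast
        thus ?thesis unfolding closed_nbhd_def by blast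
      qed }
    thus ?L using S assms(1) unfolding pds_def by blast
  qed
  hence "{S. pds V N S} = {S. S \<subseteq> A \<union> B \<and> S \<inter> A \<in> {S. pds A N S} \<and> S \<inter> B \<in> {S. pds B N S}}"
    by blast
  moreover have "finite A" "finite B" using finite_V assms(1) by auto
  ultimately show ?thesis
    unfolding pds_poly_def
    by (simp only:) (rule sum_monom_card_union, auto simp: assms(2) pds_def)
qed

lemma empty_not_pds: "V \<noteq> {} \<Longrightarrow> \<not> pds V N {}"
  unfolding pds_def fort_def by auto

lemma poly_pds_poly_0:
  assumes "V \<noteq> {}"
  shows "poly (pds_poly V N) 0 = 0"
proof -
  have "{S. pds V N S \<and> card S = 0} = {}"
    using empty_not_pds[OF assms] finite_V by (metis (mono_tags, lifting) card_0_eq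
        empty_Collect_eq finite_subset pds_subset)
  thus ?thesis by (simp only: poly_0_coeff_0 coeff_pds_poly[OF finite_V] card.empty of_nat_0)
qed

text \<open>Complementation turns a count of large power dominating sets into a count of the few
  small sets whose removal destroys the property.\<close>

lemma card_pds_complement:
  assumes "k \<le> card V"
  shows "card {S. pds V N S \<and> card S = card V - k} +
    card {W. W \<subseteq> V \<and> card W = k \<and> \<not> pds V N (V - W)} = card V choose k"
proof -
  let ?X = "{W. W \<subseteq> V \<and> card W = k \<and> pds V N (V - W)}"
  let ?Y = "{W. W \<subseteq> V \<and> card W = k \<and> \<not> pds V N (V - W)}"
  have cd: "card (V - W) = card V - card W" if "W \<subseteq> V" for W
    using that finite_V by (simp add: card_Diff_subset finite_subset)
  have "bij_betw (\<lambda>S. V - S) {S. pds V N S \<and> card S = card V - k} ?X"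
  proof (rule bij_betw_byWitness[where f' = "\<lambda>S. V - S"])
    show "(\<lambda>S. V - S) ` {S. pds V N S \<and> card S = card V - k} \<subseteq> ?X"
      using assms by (auto simp: cd pds_def double_diff)
    show "(\<lambda>S. V - S) ` ?X \<subseteq> {S. pds V N S \<and> card S = card V - k}"
      using assms by (auto simp: cd)
  qed (auto simp: pds_def)
  hence "card {S. pds V N S \<and> card S = card V - k} = card ?X" by (rule bij_betw_same_card)
  moreover have "card ?X + card ?Y = card (?X \<union> ?Y)"
    using finite_V by (subst card_Un_disjoint) auto
  moreover have "?X \<union> ?Y = {W. W \<subseteq> V \<and> card W = k}" by blast
  ultimately show ?thesis by (simp add: n_subsets[OF finite_V])
qed

lemma degree_pds_poly: "degree (pds_poly V N) = card V"
  and lead_coeff_pds_poly: "coeff (pds_poly V N) (card V) = 1"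
proof -
  have "pds V N S \<and> card S = card V \<longleftrightarrow> S = V" for S
    using pds_univ[of V N] pds_subset[of V N S] card_subset_eq[OF finite_V, of S] by blast
  hence "{S. pds V N S \<and> card S = card V} = {V}" by simp
  thus top: "coeff (pds_poly V N) (card V) = 1" by (simp add: coeff_pds_poly[OF finite_V])
  have "{S. pds V N S \<and> card S = i} = {}" if "card V < i" for i
  proof -
    have "card S \<noteq> i" if "pds V N S" for S
      using card_mono[OF finite_V pds_subset[OF that]] \<open>card V < i\<close> by simp
    thus ?thesis by blast
  qed
  hence "degree (pds_poly V N) \<le> card V"
    by (intro degree_le allI impI) (simp only: coeff_pds_poly[OF finite_V] card.empty of_nat_0)
  with top show "degree (pds_poly V N) = card V"
    by (intro antisym le_degree) simp_all
qed

definition private_nbrs :: "'a set \<Rightarrow> 'a \<Rightarrow> 'a set" where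
  "private_nbrs S s = {w \<in> V - S. N w \<inter> S = {s}}"

lemma finite_private_nbrs: "finite (private_nbrs S s)"
  using finite_V by (simp add: private_nbrs_def)

lemma private_nbrs_subset_N: "private_nbrs S s \<subseteq> N s"
  unfolding private_nbrs_def using N_sym by blast

text \<open>Suppose \<open>T\<close> misses the closed neighbourhood of a fort \<open>U\<close>.
  Then \<open>v\<close> is outside \<open>U\<close> but adjacent to it, hence has at least two
  neighbours in \<open>U\<close>. All of these are private to \<open>v\<close>, since any other
  member of \<open>S\<close> adjacent to one would lie in \<open>T\<close>.\<close>

lemma pds_exchange:
  assumes S: "pds V N S" and "v \<in> S" and e: "card (private_nbrs S v) \<le> 1"
    and "S - {v} \<subseteq> T" "T \<subseteq> V" "T \<inter> N v \<noteq> {}"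
  shows "pds V N T"
proof (rule ccontr)
  assume "\<not> pds V N T"
  then obtain U where U: "fort V N U" "T \<inter> closed_nbhd N U = {}"
    using assms(5) by (rule not_pdsE)
  have UV: "U \<subseteq> V" using U by (simp add: fort_def)
  have "v \<in> V" using assms(1,2) by (auto simp: pds_def)
  have "S \<inter> closed_nbhd N U \<noteq> {}" using S U unfolding pds_def by blast
  hence v: "v \<in> closed_nbhd N U" using U(2) assms(4) by blast
  have "v \<notin> U" using U(2) assms(6) unfolding closed_nbhd_def by blast
  then obtain u where u: "u \<in> U" "v \<in> N u" using v unfolding closed_nbhd_def by blast
  hence "u \<in> N v \<inter> U" using N_sym UV by blast
  moreover have "card (N v \<inter> U) \<noteq> 1" using U(1) \<open>v \<notin> U\<close> \<open>v \<in> V\<close> unfolding fort_def by blast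
  moreover have "finite (N v \<inter> U)" using finite_N[OF \<open>v \<in> V\<close>] by simp
  ultimately have "2 \<le> card (N v \<inter> U)"
    by (metis One_nat_def Suc_1 card_0_eq empty_iff less_one linorder_not_less not_less_eq_eq le_antisym)
  moreover have "N v \<inter> U \<subseteq> private_nbrs S v"
  proof
    fix x assume x: "x \<in> N v \<inter> U"
    hence "x \<notin> S" using U(2) assms(4) \<open>v \<notin> U\<close> unfolding closed_nbhd_def by blast
    moreover have "N x \<inter> S \<subseteq> {v}" using U(2) assms(4) x unfolding closed_nbhd_def by blast
    moreover have "v \<in> N x" using x N_sym[OF \<open>v \<in> V\<close>] by blast
    ultimately show "x \<in> private_nbrs S v" using x UV \<open>v \<in> S\<close> unfolding private_nbrs_def by blast
  qed
  ultimately show False using e card_mono[OF finite_private_nbrs, of "N v \<inter> U" S v] by linarith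
qed

end

section \<open>Graphs in which every component has at least three vertices\<close>

locale nbhd_graph_large = nbhd_graph +
  assumes no_isolated: "v \<in> V \<Longrightarrow> N v \<noteq> {}"
    and no_K2: "v \<in> V \<Longrightarrow> N v = {u} \<Longrightarrow> N u \<noteq> {v}"
begin

text \<open>A vertex outside the fort that is adjacent to it has two neighbours in it. If there is
  no such vertex, the fort is a union of components, and a component with at least three vertices
  contains a path on three vertices.\<close>

lemma fort_three_vertices:
  assumes "fort V N U"
  obtains a b c where "a \<noteq> b" "a \<noteq> c" "b \<noteq> c" "a \<in> U" "b \<in> U" "c \<in> N a" "c \<in> N b"
proof -
  have UV: "U \<subseteq> V" "U \<noteq> {}" using assms by (auto simp: fort_def)
  show ?thesis
  proof (cases "\<exists>v\<in>U. \<exists>u\<in>N v. u \<notin> U")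
    case True
    then obtain v u where vu: "v \<in> U" "u \<in> N v" "u \<notin> U" by blast
    hence "u \<in> V" using UV N_subset by blast
    hence "card (N u \<inter> U) \<noteq> 1" using assms vu unfolding fort_def by blast
    moreover have "v \<in> N u \<inter> U" using vu UV N_sym by blast
    ultimately obtain w where "w \<in> N u \<inter> U" "w \<noteq> v"
      by (metis One_nat_def card.empty card.insert empty_iff finite.emptyI insertI1 insert_absorb
          is_singletonI' is_singleton_altdef)
    hence "w \<noteq> u" "u \<in> N w" using vu N_sym[OF \<open>u \<in> V\<close>] by auto
    thus ?thesis using that[of v w u] vu \<open>w \<in> N u \<inter> U\<close> \<open>w \<noteq> v\<close> by blast
  next
    case False
    obtain v where "v \<in> U" using UV by blast
    then obtain u where "u \<in> N v" using no_isolated UV by blast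
    have "u \<in> U" "u \<in> V" "v \<in> V" "v \<in> N u" using False \<open>u \<in> N v\<close> \<open>v \<in> U\<close> UV N_sym by blast+
    have "u \<noteq> v" using \<open>u \<in> N v\<close> N_irrefl \<open>v \<in> V\<close> by blast
    have "N v \<noteq> {u} \<or> N u \<noteq> {v}" using no_K2 \<open>v \<in> V\<close> by blast
    thus ?thesis
    proof
      assume "N v \<noteq> {u}"
      then obtain w where "w \<in> N v" "w \<noteq> u" using \<open>u \<in> N v\<close> by blast
      moreover have "w \<in> U" "w \<noteq> v" "v \<in> N w"
        using \<open>w \<in> N v\<close> False \<open>v \<in> U\<close> \<open>v \<in> V\<close> N_irrefl N_sym by blast+
      ultimately show ?thesis using that[of u w v] \<open>u \<in> U\<close> \<open>u \<noteq> v\<close> \<open>v \<in> N u\<close> by blast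
    next
      assume "N u \<noteq> {v}"
      then obtain w where "w \<in> N u" "w \<noteq> v" using \<open>v \<in> N u\<close> by blast
      moreover have "w \<in> U" "w \<noteq> u" "u \<in> N w"
        using \<open>w \<in> N u\<close> False \<open>u \<in> U\<close> \<open>u \<in> V\<close> N_irrefl N_sym by blast+
      ultimately show ?thesis using that[of v w u] \<open>v \<in> U\<close> \<open>u \<noteq> v\<close> \<open>u \<in> N v\<close> by blast
    qed
  qed
qed

lemma closed_nbhd_subset: "U \<subseteq> V \<Longrightarrow> closed_nbhd N U \<subseteq> V"
  unfolding closed_nbhd_def using N_subset by blast

lemma card_closed_nbhd_fort:
  assumes "fort V N U"
  shows "3 \<le> card (closed_nbhd N U)"
proof -
  obtain a b c where abc: "a \<noteq> b" "a \<noteq> c" "b \<noteq> c" "a \<in> U" "b \<in> U" "c \<in> N a" "c \<in> N b"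
    using fort_three_vertices[OF assms] .
  have "{a, b, c} \<subseteq> closed_nbhd N U" using abc unfolding closed_nbhd_def by blast
  moreover have "finite (closed_nbhd N U)"
    using finite_subset[OF closed_nbhd_subset[of U] finite_V] assms by (simp add: fort_def)
  ultimately have "card {a, b, c} \<le> card (closed_nbhd N U)" by (intro card_mono)
  thus ?thesis using abc by simp
qed

lemma pds_complement_small:
  assumes "W \<subseteq> V" "card W \<le> 2"
  shows "pds V N (V - W)"
proof (rule ccontr)
  assume "\<not> pds V N (V - W)"
  then obtain U where U: "fort V N U" "(V - W) \<inter> closed_nbhd N U = {}"
    by (rule not_pdsE) auto
  hence "closed_nbhd N U \<subseteq> W" using closed_nbhd_subset unfolding fort_def by blast
  hence "card (closed_nbhd N U) \<le> 2"
    using assms finite_V card_mono finite_subset le_trans by metis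
  with card_closed_nbhd_fort[OF U(1)] show False by simp
qed

text \<open>These are the closed neighbourhoods of forts of the smallest possible size,
  three.\<close>

definition critical_triples :: "'a set set" where
  "critical_triples = {W. W \<subseteq> V \<and> card W = 3 \<and> \<not> pds V N (V - W)}"

text \<open>The triple contains the closed neighbourhood of a fort, which has at least three
  vertices and so fills the triple. The two fort vertices \<open>a\<close> and \<open>b\<close> can
  then have no neighbours outside it.\<close>

lemma critical_triplesE:
  assumes "W \<in> critical_triples"
  obtains a b c where "W = {a, b, c}" "leaf_pair N c a b" "\<And>S. pds V N S \<Longrightarrow> S \<inter> W \<noteq> {}"
proof -
  have W: "W \<subseteq> V" "card W = 3" "\<not> pds V N (V - W)" using assms by (auto simp: critical_triples_def)
  obtain U where U: "fort V N U" "(V - W) \<inter> closed_nbhd N U = {}"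
    using W(3) by (rule not_pdsE) auto
  hence UV: "U \<subseteq> V" by (simp add: fort_def)
  have "closed_nbhd N U \<subseteq> W" using closed_nbhd_subset[OF UV] U(2) by blast
  moreover have "finite W" using W(2) by (simp add: card_ge_0_finite)
  ultimately have cW: "closed_nbhd N U = W"
    using card_closed_nbhd_fort[OF U(1)] W(2) by (intro card_seteq) auto
  obtain a b c where abc: "a \<noteq> b" "a \<noteq> c" "b \<noteq> c" "a \<in> U" "b \<in> U" "c \<in> N a" "c \<in> N b"
    using fort_three_vertices[OF U(1)] .
  have "{a, b, c} \<subseteq> W" using abc cW unfolding closed_nbhd_def by blast
  hence Weq: "W = {a, b, c}"
    using abc W(2) \<open>finite W\<close> by (intro card_seteq[symmetric]) auto
  have "N a \<subseteq> W" "N b \<subseteq> W" using abc cW unfolding closed_nbhd_def by blast+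
  hence "leaf_pair N c a b"
    using abc Weq N_irrefl[of a] N_irrefl[of b] UV unfolding leaf_pair_def by blast
  moreover have "S \<inter> W \<noteq> {}" if "pds V N S" for S
    using that U(1) cW unfolding pds_def by blast
  ultimately show ?thesis using that Weq by blast
qed

lemma top_coeffs_pds_poly:
  assumes "3 \<le> card V"
  shows "coeff (pds_poly V N) (card V - 1) = of_nat (card V)"
    and "coeff (pds_poly V N) (card V - 2) = of_nat (card V choose 2)"
    and "coeff (pds_poly V N) (card V - 3) = of_nat (card V choose 3) - of_nat (card critical_triples)"
proof -
  have none: "{W. W \<subseteq> V \<and> card W = k \<and> \<not> pds V N (V - W)} = {}" if "k \<le> 2" for k
    using that pds_complement_small by auto
  have cd: "card {S. pds V N S \<and> card S = card V - k} = card V choose k" if "k \<le> 2" for k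
    using card_pds_complement[of k] none[OF that] that assms by simp
  show "coeff (pds_poly V N) (card V - 1) = of_nat (card V)"
    using cd[of 1] by (simp add: coeff_pds_poly[OF finite_V])
  show "coeff (pds_poly V N) (card V - 2) = of_nat (card V choose 2)"
    using cd[of 2] by (simp add: coeff_pds_poly[OF finite_V])
  show "coeff (pds_poly V N) (card V - 3) = of_nat (card V choose 3) - of_nat (card critical_triples)"
    using card_pds_complement[of 3] assms
    by (simp add: coeff_pds_poly[OF finite_V] critical_triples_def eq_diff_eq flip: of_nat_add)
qed

lemma pds_two_private_neighbours:
  obtains S where "pds V N S" "\<And>s. s \<in> S \<Longrightarrow> 2 \<le> card (private_nbrs S s)"
proof -
  obtain S0 where S0: "pds V N S0" "\<And>T. pds V N T \<Longrightarrow> card S0 \<le> card T"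
    using ex_has_least_nat[of "pds V N" V card] pds_univ by blast
  \<comment> \<open>Among the minimum sets, take one that maximises the number of vertices with a neighbour in \<open>S\<close>
    plus the number of vertices of degree at least two. A vertex with at most one private neighbour
    can be exchanged for one of its neighbours, which would increase this quantity.\<close>
  define C where "C S = {s \<in> S. N s \<inter> S \<noteq> {}}" for S
  define D where "D S = {s \<in> S. 2 \<le> card (N s)}" for S
  have fin: "finite S" if "pds V N S" for S
    using that finite_V finite_subset unfolding pds_def by blast
  have "card (C S) + card (D S) \<le> 2 * card V" if "pds V N S" for S
  proof -
    have "C S \<subseteq> V" "D S \<subseteq> V" using that unfolding C_def D_def pds_def by auto
    thus ?thesis using card_mono[OF finite_V, of "C S"] card_mono[OF finite_V, of "D S"] by simp
  qed
  \<comment> \<open>A maximum exists because the quantity is at most twice the number of vertices;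
    \<open>Suc\<close> turns this into the strict bound asked for.\<close>
  hence "\<exists>S. (pds V N S \<and> card S = card S0) \<and>
      (\<forall>T. pds V N T \<and> card T = card S0 \<longrightarrow> card (C T) + card (D T) \<le> card (C S) + card (D S))"
    using S0(1) by (intro ex_has_greatest_nat[of _ S0 _ "Suc (2 * card V)"]) (auto simp: less_Suc_eq_le)
  then obtain S where S: "pds V N S" "card S = card S0"
    and best: "\<And>T. pds V N T \<Longrightarrow> card T = card S0 \<Longrightarrow> card (C T) + card (D T) \<le> card (C S) + card (D S)"
    by blast
  have SV: "S \<subseteq> V" using S(1) by (simp add: pds_def)
  have "2 \<le> card (private_nbrs S v)" if "v \<in> S" for v
  proof (rule ccontr)
    assume "\<not> 2 \<le> card (private_nbrs S v)"
    hence e: "card (private_nbrs S v) \<le> 1" by simp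
    have "v \<in> V" using that SV by blast
    \<comment> \<open>If \<open>v\<close> had a neighbour in \<open>S\<close>, it could simply be
      dropped, against minimality.\<close>
    have iso: "N v \<inter> S = {}"
    proof (rule ccontr)
      assume "N v \<inter> S \<noteq> {}"
      hence "(S - {v}) \<inter> N v \<noteq> {}" using N_irrefl[OF \<open>v \<in> V\<close>] by blast
      hence "pds V N (S - {v})"
        using pds_exchange[OF S(1) that e, of "S - {v}"] SV by blast
      hence "card S \<le> card (S - {v})" using S0(2) S(2) by simp
      thus False using that fin[OF S(1)] by (meson card_Diff1_less linorder_not_less)
    qed
    have not_v: "v \<notin> N s" if "s \<in> S" for s using iso that SV N_sym by blast
    have exch: "pds V N (insert u (S - {v}))" "card (insert u (S - {v})) = card S0"
      "C S \<subseteq> C (insert u (S - {v}))" "D S - {v} \<subseteq> D (insert u (S - {v}))"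
      if "u \<in> N v" for u
    proof -
      have "u \<notin> S" "u \<in> V" using that iso N_subset \<open>v \<in> V\<close> by blast+
      show "pds V N (insert u (S - {v}))"
        by (rule pds_exchange[OF S(1) \<open>v \<in> S\<close> e]) (use that SV \<open>u \<in> V\<close> in auto)
      show "card (insert u (S - {v})) = card S0"
        using \<open>u \<notin> S\<close> \<open>v \<in> S\<close> fin[OF S(1)] S(2) by (metis card.remove card_insert_disjoint finite_Diff Diff_iff)
      show "C S \<subseteq> C (insert u (S - {v}))" using not_v iso unfolding C_def by blast
      show "D S - {v} \<subseteq> D (insert u (S - {v}))" unfolding D_def by blast
    qed
    have finCD: "finite (C T)" "finite (D T)" if "pds V N T" for T
      using fin[OF that] by (auto simp: C_def D_def)
    have deg: "2 \<le> card (N u)" if "u \<in> V" "x \<in> N u" "y \<in> N u" "x \<noteq> y" for u x y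
      using card_mono[OF finite_N[OF that(1)], of "{x, y}"] that by auto
    show False
    proof (cases "N v \<subseteq> private_nbrs S v")
      \<comment> \<open>Some neighbour \<open>u\<close> of \<open>v\<close> is also adjacent to
        another \<open>s\<close> in \<open>S\<close>. After the exchange \<open>u\<close> belongs to
        both \<open>C\<close> and \<open>D\<close>, so \<open>C\<close> grows, and \<open>D\<close>
        loses at most \<open>v\<close> but gains \<open>u\<close>.\<close>
      case False
      then obtain u where u: "u \<in> N v" "u \<notin> private_nbrs S v" by blast
      let ?T = "insert u (S - {v})"
      have uV: "u \<in> V" "u \<notin> S" "v \<in> N u" using u iso N_subset N_sym \<open>v \<in> V\<close> by blast+
      then obtain s where s: "s \<in> S" "s \<noteq> v" "s \<in> N u" using u \<open>v \<in> S\<close> unfolding private_nbrs_def by blast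
      note T = exch[OF u(1)]
      have "u \<in> C ?T" "u \<notin> C S" using s uV unfolding C_def by auto
      hence "card (C S) < card (C ?T)" using T(3) finCD(1)[OF T(1)] by (intro psubset_card_mono) auto
      moreover have "card (D S) \<le> card (D ?T)"
      proof -
        have "u \<in> D ?T" using deg[of u v s] s uV unfolding D_def by auto
        hence "insert u (D S - {v}) \<subseteq> D ?T" using T(4) by blast
        hence "card (insert u (D S - {v})) \<le> card (D ?T)" using finCD(2)[OF T(1)] by (intro card_mono)
        moreover have "u \<notin> D S - {v}" using uV unfolding D_def by blast
        ultimately show ?thesis
          using finCD(2)[OF S(1)] by (simp add: card_Diff_singleton_if split: if_splits)
      qed
      ultimately show False using best[OF T(1,2)] by simp
    next
      \<comment> \<open>All neighbours of \<open>v\<close> are private, so \<open>v\<close> is a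
        leaf. Its neighbour \<open>w\<close> has degree at least two, so the exchange enlarges
        \<open>D\<close> and loses nothing from \<open>C\<close>.\<close>
      case True
      hence "card (N v) \<le> 1" using card_mono[OF finite_private_nbrs True] e by simp
      moreover have "N v \<noteq> {}" using no_isolated \<open>v \<in> V\<close> by blast
      ultimately obtain w where w: "N v = {w}"
        using finite_N[OF \<open>v \<in> V\<close>] by (metis card_1_singletonE card_0_eq le_antisym less_one linorder_not_less)
      let ?T = "insert w (S - {v})"
      have wV: "w \<in> V" "w \<notin> S" "v \<in> N w" using w iso N_subset N_sym \<open>v \<in> V\<close> by blast+
      have "N w \<noteq> {v}" using no_K2[OF \<open>v \<in> V\<close> w] .
      then obtain x where x: "x \<in> N w" "x \<noteq> v" using wV by blast
      have "w \<in> N v" using w by simp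
      note T = exch[OF this]
      have "v \<notin> D S" using w unfolding D_def by simp
      have "w \<in> D ?T" "w \<notin> D S" using deg[of w v x] x wV unfolding D_def by auto
      hence "D S \<subset> D ?T" using T(4) \<open>v \<notin> D S\<close> by blast
      hence "card (D S) < card (D ?T)" using finCD(2)[OF T(1)] by (intro psubset_card_mono) auto
      moreover have "card (C S) \<le> card (C ?T)" using T(3) finCD(1)[OF T(1)] by (intro card_mono)
      ultimately show False using best[OF T(1,2)] by simp
    qed
  qed
  thus ?thesis using that S(1) by blast
qed

end

section \<open>Private blocks and critical triples\<close>

context nbhd_graph_large
begin

text \<open>A private neighbour lies outside \<open>S\<close> and determines its vertex of
  \<open>S\<close>, so the blocks are disjoint, of size at least three each. Equality in the
  resulting count makes all of them triples that cover \<open>V\<close>.\<close>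

lemma card_private_blocks:
  assumes "pds V N S" "\<And>s. s \<in> S \<Longrightarrow> 2 \<le> card (private_nbrs S s)"
  defines "blk \<equiv> \<lambda>s. insert s (private_nbrs S s)"
  shows "3 * card S \<le> card V"
    and "\<lbrakk>card V = 3 * card S; s \<in> S\<rbrakk> \<Longrightarrow> card (blk s) = 3"
    and "card V = 3 * card S \<Longrightarrow> (\<Union>s\<in>S. blk s) = V"
    and "\<lbrakk>s \<in> S; t \<in> S; s \<noteq> t\<rbrakk> \<Longrightarrow> blk s \<inter> blk t = {}"
proof -
  have SV: "S \<subseteq> V" using assms(1) by (rule pds_subset)
  have finS: "finite S" using SV finite_V finite_subset by blast
  have dj: "blk s \<inter> blk t = {}" if "s \<in> S" "t \<in> S" "s \<noteq> t" for s t
    using that unfolding blk_def private_nbrs_def by blast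
  have cb: "card (blk s) = Suc (card (private_nbrs S s))" if "s \<in> S" for s
    using that finite_private_nbrs[of S s] unfolding blk_def by (subst card_insert_disjoint) (auto simp: private_nbrs_def)
  hence three: "3 \<le> card (blk s)" if "s \<in> S" for s
    using assms(2)[OF that] that by simp
  have sub: "(\<Union>s\<in>S. blk s) \<subseteq> V" using SV unfolding blk_def private_nbrs_def by blast
  have cU: "card (\<Union>s\<in>S. blk s) = (\<Sum>s\<in>S. card (blk s))"
    using finS dj by (intro card_UN_disjoint) (auto simp: blk_def finite_private_nbrs)
  have le: "(\<Sum>s\<in>S. card (blk s)) \<le> card V" using card_mono[OF finite_V sub] cU by simp
  have ge: "(\<Sum>s\<in>S. 3) \<le> (\<Sum>s\<in>S. card (blk s))" using three by (intro sum_mono)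
  show "3 * card S \<le> card V" using le ge by simp
  show "card (blk s) = 3" if eq: "card V = 3 * card S" and s: "s \<in> S"
  proof (rule ccontr)
    assume "card (blk s) \<noteq> 3"
    hence "3 < card (blk s)" using three[OF s] by simp
    hence "(\<Sum>s\<in>S. 3) < (\<Sum>s\<in>S. card (blk s))"
      using three s finS by (intro sum_strict_mono_ex1) auto
    thus False using le eq by simp
  qed
  show "(\<Union>s\<in>S. blk s) = V" if "card V = 3 * card S"
    using sub le ge cU that finite_V by (intro card_seteq) auto
  show "\<lbrakk>s \<in> S; t \<in> S; s \<noteq> t\<rbrakk> \<Longrightarrow> blk s \<inter> blk t = {}" by (rule dj)
qed

text \<open>The set \<open>S\<close> meets the triple. If it contains the centre \<open>c\<close>,
  both leaves are private neighbours of \<open>c\<close>; if it contains only leaves, the two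
  neighbours available to such a leaf must both be private. In either case the triple is contained
  in a block of size three.\<close>

lemma critical_triple_is_private_block:
  assumes S: "pds V N S" "\<And>s. s \<in> S \<Longrightarrow> 2 \<le> card (private_nbrs S s)" and "card V = 3 * card S"
    and W: "W \<in> critical_triples"
  shows "\<exists>s\<in>S. W = insert s (private_nbrs S s)"
proof -
  obtain a b c where abc: "W = {a, b, c}" "leaf_pair N c a b" and hit: "S \<inter> W \<noteq> {}"
    using critical_triplesE[OF W] S(1) by metis
  have WV: "W \<subseteq> V" "card W = 3" using W by (auto simp: critical_triples_def)
  have eq: "W = insert s (private_nbrs S s)" if "s \<in> S" "W \<subseteq> insert s (private_nbrs S s)" for s
    using that card_private_blocks(2)[OF S assms(3) that(1)] WV(2) finite_private_nbrs
    by (intro card_seteq) auto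
  have big: False if "s \<in> S" "private_nbrs S s \<subseteq> {x}" for s x
    using S(2)[OF that(1)] card_mono[OF _ that(2)] by simp
  have leaf: "W = insert x (private_nbrs S x)"
    if "x \<in> S" "N x \<subseteq> {y, c}" "W = {x, y, c}" for x y
  proof -
    have "private_nbrs S x \<subseteq> {y, c}" using that(2) private_nbrs_subset_N by blast
    hence "private_nbrs S x = {y, c}" using big[OF that(1), of y] big[OF that(1), of c] by blast
    thus ?thesis using that(3) by simp
  qed
  show ?thesis
  proof (cases "c \<in> S")
    case True
    have priv: "x \<in> private_nbrs S c" if "c \<in> N x" "N x \<subseteq> {y, c}" "W = {x, y, c}" "x \<noteq> c" "N y \<subseteq> {x, c}" for x y
    proof -
      \<comment> \<open>With \<open>c\<close> in \<open>S\<close>, a leaf in \<open>S\<close> would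
        keep at most one candidate for a private neighbour.\<close>
      have "z \<notin> S" if "N z \<subseteq> {w, c}" for z w
      proof
        assume "z \<in> S"
        have "private_nbrs S z \<subseteq> {w}" using private_nbrs_subset_N[of S z] that True unfolding private_nbrs_def by blast
        thus False using big[OF \<open>z \<in> S\<close>] by blast
      qed
      hence "x \<notin> S" "y \<notin> S" using that(2,5) by blast+
      thus ?thesis using that True WV(1) unfolding private_nbrs_def by blast
    qed
    have "a \<in> private_nbrs S c" "b \<in> private_nbrs S c"
      using priv[of a b] priv[of b a] abc unfolding leaf_pair_def by (auto simp: insert_commute)
    thus ?thesis using True eq[of c] abc(1) by blast
  next
    case False
    hence "a \<in> S \<or> b \<in> S" using hit abc(1) by blast
    thus ?thesis using leaf[of a b] leaf[of b a] abc unfolding leaf_pair_def by (auto simp: insert_commute)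
  qed
qed

text \<open>Containment suffices as a hypothesis because the theorem is applied to one factor of the
  whole polynomial. The rigidity lemma is used with \<open>k = card S\<close>, and its value of
  \<open>g\<close> turns the inclusion of critical triples among blocks into equality.\<close>

theorem three_roots_imp_critical_partition:
  assumes "V \<noteq> {}" and sub: "{z. poly (pds_poly V N) z = 0} \<subseteq> {0, a, b}"
    and ab: "a \<noteq> 0" "b \<noteq> 0" "a \<noteq> b"
  shows "a \<notin> \<real> \<and> b \<notin> \<real> \<and> disjoint critical_triples \<and> \<Union>critical_triples = V"
proof -
  obtain S where S: "pds V N S" "\<And>s. s \<in> S \<Longrightarrow> 2 \<le> card (private_nbrs S s)"
    using pds_two_private_neighbours by blast
  note blocks = card_private_blocks[OF S]
  have finS: "finite S" using pds_subset[OF S(1)] finite_V finite_subset by blast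
  have "S \<noteq> {}" using S(1) empty_not_pds[OF assms(1)] by blast
  hence "3 \<le> card V" using blocks(1) finS by (metis One_nat_def Suc_leI card_gt_0_iff le_trans mult.right_neutral mult_le_mono2)
  have "coeff (pds_poly V N) (card S) \<noteq> 0"
    using S(1) finite_pds[OF finite_V, of N]
    by (auto simp: coeff_pds_poly[OF finite_V] card_eq_0_iff intro: finite_subset)
  have ints: "coeff (pds_poly V N) i \<in> \<int>" for i by (simp add: coeff_pds_poly[OF finite_V])
  have res: "card V = 3 * card S \<and> card critical_triples = card S \<and> a \<notin> \<real> \<and> b \<notin> \<real>"
    by (rule three_roots_rigidity[OF degree_pds_poly ints lead_coeff_pds_poly
          top_coeffs_pds_poly[OF \<open>3 \<le> card V\<close>] poly_pds_poly_0[OF assms(1)]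
          \<open>coeff (pds_poly V N) (card S) \<noteq> 0\<close> blocks(1) sub ab])
  let ?blk = "\<lambda>s. insert s (private_nbrs S s)"
  have "critical_triples \<subseteq> ?blk ` S"
    using critical_triple_is_private_block[OF S] res by blast
  moreover have "card (?blk ` S) \<le> card critical_triples"
    using card_image_le[OF finS] res by simp
  ultimately have eq: "critical_triples = ?blk ` S"
    using finS by (intro card_seteq) auto
  show ?thesis
    unfolding eq using res blocks(3,4) by (fastforce simp: pairwise_def disjnt_def)
qed

end

text \<open>
  The shape of \<open>G\<^sub>1 \<union> \<dots> \<union> G\<^sub>k \<union> edgeless r\<close> stated inside the graph itself: each triple consists of a
  vertex of some \<open>H\<^sub>i\<close> with its two new vertices.
\<close>

definition leaf_partition :: "'a set \<Rightarrow> ('a \<Rightarrow> 'a set) \<Rightarrow> 'a set set \<Rightarrow> bool" where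
  "leaf_partition V N \<G> \<longleftrightarrow> \<G> \<noteq> {} \<and> disjoint \<G> \<and> \<Union>\<G> \<subseteq> V \<and>
     (\<forall>W\<in>\<G>. \<exists>a b c. W = {a, b, c} \<and> leaf_pair N c a b) \<and> (\<forall>v\<in>V - \<Union>\<G>. N v = {})"

section \<open>Small components, and leaf partitions versus three roots\<close>

context nbhd_graph
begin

text \<open>The union of the components with one or two vertices.\<close>

definition small :: "'a set" where
  "small = {v \<in> V. N v = {} \<or> (\<exists>u. N v = {u} \<and> N u = {v})}"

lemma small_closed: "v \<in> small \<Longrightarrow> N v \<subseteq> small"
  unfolding small_def using N_subset by auto

lemma large_closed: "v \<in> V - small \<Longrightarrow> N v \<subseteq> V - small"
proof
  fix u assume v: "v \<in> V - small" and u: "u \<in> N v"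
  have "v \<in> N u" "u \<in> V" using v u N_sym N_subset by blast+
  moreover have "v \<in> small" if "u \<in> small"
    using small_closed[OF that] \<open>v \<in> N u\<close> by blast
  ultimately show "u \<in> V - small" using v by blast
qed

lemma nbhd_graph_large_part: "nbhd_graph_large (V - small) N"
proof
  show "finite (V - small)" using finite_V by simp
  show "N v \<subseteq> V - small" if "v \<in> V - small" for v using large_closed[OF that] .
  show "v \<in> N u" if "v \<in> V - small" "u \<in> N v" for u v using that N_sym by blast
  show "v \<notin> N v" if "v \<in> V - small" for v using that N_irrefl by blast
  show "N v \<noteq> {}" if "v \<in> V - small" for v using that unfolding small_def by blast
  show "N u \<noteq> {v}" if "v \<in> V - small" "N v = {u}" for v u
    using that unfolding small_def by blast
qed

text \<open>In a component with one or two vertices any single vertex suffices, so the blocks to be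
  hit are the components themselves, written as \<open>insert v (N v)\<close>.\<close>

lemma poly_pds_poly_small:
  "poly (pds_poly small N) z = 0 \<longleftrightarrow> (\<exists>v\<in>small. (1 + z) ^ card (insert v (N v)) = 1)"
proof -
  let ?b = "\<lambda>v. insert v (N v)"
  have fin: "finite small" using finite_V by (simp add: small_def)
  have same: "?b u = ?b v" if "v \<in> small" "u \<in> ?b v" for u v
    using that unfolding small_def by auto
  have "pds_poly small N = (\<Prod>B\<in>?b ` small. [:1, 1:] ^ card B - 1)"
  proof (rule pds_poly_hitting_sets)
    show "finite (?b ` small)" using fin by simp
    show "finite B" if "B \<in> ?b ` small" for B using that finite_N by (auto simp: small_def)
    show "disjoint (?b ` small)"
    proof (rule disjointI)
      fix A B assume AB: "A \<in> ?b ` small" "B \<in> ?b ` small" "A \<noteq> B"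
      then obtain u v where uv: "u \<in> small" "v \<in> small" "A = ?b u" "B = ?b v" by blast
      { fix x assume "x \<in> A" "x \<in> B"
        hence "A = B" using same[of u x] same[of v x] uv by simp }
      thus "A \<inter> B = {}" using AB(3) by blast
    qed
    show "\<Union> (?b ` small) = small" using small_closed by blast
  next
    fix B assume "B \<in> ?b ` small"
    then obtain v where v: "v \<in> small" "B = ?b v" by blast
    have Bs: "B \<subseteq> small" using small_closed[OF v(1)] v by blast
    have cl: "N x \<subseteq> B" if "x \<in> B" for x using same[OF v(1), of x] that v(2) by blast
    have "card (N x \<inter> B) \<noteq> 1" if x: "x \<in> small - B" for x
    proof -
      have "N x \<inter> B = {}"
      proof (rule ccontr)
        assume "N x \<inter> B \<noteq> {}"
        then obtain y where "y \<in> N x" "y \<in> B" by blast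
        hence "x \<in> N y" using N_sym x by (auto simp: small_def)
        thus False using cl[OF \<open>y \<in> B\<close>] x by blast
      qed
      thus ?thesis by simp
    qed
    hence "fort small N B" using Bs v(2) unfolding fort_def by blast
    moreover have "closed_nbhd N B \<subseteq> B" using cl unfolding closed_nbhd_def by blast
    ultimately show "\<exists>U. fort small N U \<and> closed_nbhd N U \<subseteq> B" by blast
  next
    fix U assume "fort small N U"
    then obtain v where "v \<in> U" "v \<in> small" unfolding fort_def by blast
    moreover have "?b v \<subseteq> closed_nbhd N U" using \<open>v \<in> U\<close> unfolding closed_nbhd_def by blast
    ultimately show "\<exists>B\<in>?b ` small. B \<subseteq> closed_nbhd N U" by blast
  qed
  hence "poly (pds_poly small N) z = 0 \<longleftrightarrow> (\<exists>B\<in>?b ` small. poly ([:1, 1:] ^ card B - 1) z = 0)"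
    using fin by (simp add: poly_prod prod_zero_iff del: image_eqI)
  also have "\<dots> \<longleftrightarrow> (\<exists>v\<in>small. (1 + z) ^ card (?b v) = 1)"
    by simp
  finally show ?thesis .
qed

text \<open>The small components alone would give only the roots 0 and -2, so the large part is
  nonempty and its critical triples partition it. It remains to see that the small part consists of
  isolated vertices.\<close>

theorem three_roots_imp_leaf_partition:
  assumes "card {z. poly (pds_poly V N) z = 0} = 3"
  shows "\<exists>\<G>. leaf_partition V N \<G>"
proof -
  let ?L = "V - small"
  interpret L: nbhd_graph_large ?L N by (rule nbhd_graph_large_part)
  have poly: "pds_poly V N = pds_poly small N * pds_poly ?L N"
    by (rule pds_poly_union) (use small_closed large_closed in \<open>auto simp: small_def\<close>)
  have "V \<noteq> {}"
  proof
    assume "V = {}"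
    hence "pds V N S \<longleftrightarrow> S = {}" for S by (auto simp: pds_def fort_def)
    hence "pds_poly V N = 1" by (simp add: pds_poly_def monom_altdef)
    thus False using assms by simp
  qed
  hence "0 \<in> {z. poly (pds_poly V N) z = 0}" using poly_pds_poly_0 by simp
  moreover from assms obtain x y w where xyz: "{z. poly (pds_poly V N) z = 0} = {x, y, w}" "x \<noteq> y" "y \<noteq> w" "x \<noteq> w"
    by (auto simp: card_3_iff)
  ultimately obtain a b where ab: "{z. poly (pds_poly V N) z = 0} = {0, a, b}" "a \<noteq> 0" "b \<noteq> 0" "a \<noteq> b"
    by (metis insert_commute insert_iff singletonD)
  have cs: "card (insert v (N v)) = (if N v = {} then 1 else 2)" if "v \<in> small" for v
    using that N_irrefl[of v] by (auto simp: small_def)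
  have "?L \<noteq> {}"
  proof
    assume "?L = {}"
    hence "pds ?L N S \<longleftrightarrow> S = {}" for S by (auto simp: pds_def fort_def)
    hence "pds_poly ?L N = 1" by (simp add: pds_poly_def monom_altdef)
    hence P: "pds_poly V N = pds_poly small N" using poly by simp
    have "z \<in> {0, -2}" if "poly (pds_poly V N) z = 0" for z
    proof -
      obtain v where "v \<in> small" "(1 + z) ^ card (insert v (N v)) = 1"
        using \<open>poly (pds_poly V N) z = 0\<close> unfolding P poly_pds_poly_small by blast
      hence "1 + z = 1 \<or> (1 + z)\<^sup>2 = 1" by (auto simp: cs split: if_splits)
      hence "z * (z + 2) = 0" by (auto simp: power2_eq_square algebra_simps)
      thus ?thesis by (simp add: eq_neg_iff_add_eq_0)
    qed
    hence "{z. poly (pds_poly V N) z = 0} \<subseteq> {0, -2}" by blast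
    hence "card {z. poly (pds_poly V N) z = 0} \<le> card {0, -2 :: complex}" by (intro card_mono) auto
    thus False using assms by simp
  qed
  moreover have "{z. poly (pds_poly ?L N) z = 0} \<subseteq> {0, a, b}" using ab(1) poly by auto
  ultimately have L: "a \<notin> \<real> \<and> b \<notin> \<real> \<and> disjoint L.critical_triples \<and> \<Union>L.critical_triples = ?L"
    using L.three_roots_imp_critical_partition ab by blast
  \<comment> \<open>A component with two vertices would contribute the root -2, whereas the nonzero
    roots are not real.\<close>
  have "N v = {}" if "v \<in> small" for v
  proof (rule ccontr)
    assume "N v \<noteq> {}"
    hence "(1 + (-2 :: complex)) ^ card (insert v (N v)) = 1" using cs[OF that] by simp
    hence "poly (pds_poly V N) (-2) = 0" using that poly poly_pds_poly_small by auto
    hence "-2 \<in> {0, a, b}" using ab(1) by blast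
    thus False using L by auto
  qed
  hence "leaf_partition V N L.critical_triples"
    using L \<open>?L \<noteq> {}\<close> L.critical_triplesE unfolding leaf_partition_def by (metis (no_types) Diff_iff Diff_subset Union_empty)
  thus ?thesis by blast
qed

text \<open>Being power dominating means meeting every triple and containing every isolated vertex,
  so the polynomial is a product of factors (1 + x)^3 - 1 and x.\<close>

theorem leaf_partition_imp_roots:
  assumes "leaf_partition V N \<G>"
  shows "{z. poly (pds_poly V N) z = 0} = {0, (- 3 + complex_of_real (sqrt 3) * \<i>) / 2,
    (- 3 - complex_of_real (sqrt 3) * \<i>) / 2}"
proof -
  have ne: "\<G> \<noteq> {}" and dj: "disjoint \<G>" and GV: "\<Union>\<G> \<subseteq> V"
    and isolated: "\<And>v. v \<in> V - \<Union>\<G> \<Longrightarrow> N v = {}"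
    using assms unfolding leaf_partition_def by simp_all
  have triple: "\<exists>a b c. W = {a, b, c} \<and> leaf_pair N c a b" if "W \<in> \<G>" for W
    using assms that unfolding leaf_partition_def by simp
  let ?I = "V - \<Union>\<G>"
  let ?B = "\<G> \<union> (\<lambda>v. {v}) ` ?I"
  have finG: "finite \<G>" by (rule finite_UnionD[OF finite_subset[OF GV finite_V]])
  have card3: "card W = 3" if W: "W \<in> \<G>" for W
  proof -
    obtain a b c where "W = {a, b, c}" "leaf_pair N c a b" using triple[OF W] by blast
    thus ?thesis by (simp add: leaf_pair_def)
  qed
  have "pds_poly V N = (\<Prod>B\<in>?B. [:1, 1:] ^ card B - 1)"
  proof (rule pds_poly_hitting_sets)
    show "finite ?B" using finG finite_V by simp
    show "finite B" if "B \<in> ?B" for B using that card3 by (auto intro: card_ge_0_finite)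
    show "disjoint ?B"
    proof (rule disjointI)
      fix A B assume "A \<in> ?B" "B \<in> ?B" "A \<noteq> B"
      thus "A \<inter> B = {}" using dj by (auto dest: disjointD)
    qed
    show "\<Union>?B = V" using GV by blast
  next
    fix B assume "B \<in> ?B"
    thus "\<exists>U. fort V N U \<and> closed_nbhd N U \<subseteq> B"
    proof
      assume "B \<in> \<G>"
      then obtain a b c where abc: "B = {a, b, c}" "leaf_pair N c a b" using triple by blast
      have BV: "B \<subseteq> V" using GV \<open>B \<in> \<G>\<close> by blast
      \<comment> \<open>The two leaves form a fort: the centre sees both of them, and every other
        outside vertex sees none. Their closed neighbourhood is the triple.\<close>
      have "card (N v \<inter> {a, b}) \<noteq> 1" if v: "v \<in> V - {a, b}" for v
      proof (cases "v = c")
        case True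
        have "N v \<inter> {a, b} = {a, b}"
          using abc BV N_sym[of a c] N_sym[of b c] True unfolding leaf_pair_def by blast
        thus ?thesis using abc(2) by (simp add: leaf_pair_def)
      next
        case False
        have "N v \<inter> {a, b} = {}"
          using abc N_sym[of v a] N_sym[of v b] False v unfolding leaf_pair_def by blast
        thus ?thesis by simp
      qed
      hence "fort V N {a, b}" using BV abc(1) unfolding fort_def by blast
      moreover have "closed_nbhd N {a, b} \<subseteq> B"
        using abc unfolding closed_nbhd_def leaf_pair_def by blast
      ultimately show ?thesis by blast
    next
      assume "B \<in> (\<lambda>v. {v}) ` ?I"
      then obtain v where v: "B = {v}" "v \<in> ?I" by blast
      have "N v = {}" using v isolated by blast
      hence "N u \<inter> {v} = {}" if "u \<in> V" for u using N_sym[OF that] by blast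
      hence "fort V N {v}" using v unfolding fort_def by simp
      moreover have "closed_nbhd N {v} \<subseteq> B" using v \<open>N v = {}\<close> by (simp add: closed_nbhd_def)
      ultimately show ?thesis by blast
    qed
  next
    fix U assume U: "fort V N U"
    then obtain u where u: "u \<in> U" "u \<in> V" unfolding fort_def by blast
    show "\<exists>B\<in>?B. B \<subseteq> closed_nbhd N U"
    proof (cases "u \<in> ?I")
      case True
      thus ?thesis using u by (intro bexI[of _ "{u}"]) (auto simp: closed_nbhd_def)
    next
      case False
      have centre: "W \<subseteq> closed_nbhd N U" if W: "W \<in> \<G>" "W = {a, b, c}" "leaf_pair N c a b" "c \<in> U" for W a b c
      proof -
        have "W \<subseteq> V" using GV W(1) by blast
        hence "a \<in> N c" "b \<in> N c" using W N_sym unfolding leaf_pair_def by blast+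
        thus ?thesis using W unfolding closed_nbhd_def by blast
      qed
      \<comment> \<open>If a fort contains a leaf but not its centre \<open>c\<close>, then
        \<open>c\<close> has a second neighbour in the fort. This is either the other leaf or lies
        in a different triple; there it must be the centre, since it is adjacent to \<open>c\<close>
        outside its own triple.\<close>
      have leaf: "\<exists>B\<in>?B. B \<subseteq> closed_nbhd N U"
        if W: "W \<in> \<G>" "W = {a, b, c}" "leaf_pair N c a b" "a \<in> U" "c \<notin> U" for W a b c
      proof -
        have WV: "W \<subseteq> V" using GV W(1) by blast
        hence "c \<in> V" "a \<in> N c \<inter> U" using W N_sym unfolding leaf_pair_def by blast+
        moreover have "card (N c \<inter> U) \<noteq> 1" using U \<open>c \<in> V\<close> W unfolding fort_def by blast
        ultimately obtain x where x: "x \<in> N c" "x \<in> U" "x \<noteq> a"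
          by (metis Int_iff is_singletonI' is_singleton_altdef empty_iff)
        have "x \<in> V" "c \<in> N x" using x \<open>c \<in> V\<close> N_subset N_sym by blast+
        show ?thesis
        proof (cases "x = b")
          case True
          hence "W \<subseteq> closed_nbhd N U" using W x(2) unfolding closed_nbhd_def leaf_pair_def by blast
          thus ?thesis using W(1) by blast
        next
          case False
          have "x \<in> \<Union>\<G>" using isolated[of x] \<open>x \<in> V\<close> \<open>c \<in> N x\<close> by blast
          then obtain W' a' b' c' where W': "W' \<in> \<G>" "x \<in> W'" "W' = {a', b', c'}" "leaf_pair N c' a' b'"
            using triple by (metis UnionE)
          have "x \<notin> W" using x False W N_irrefl[OF \<open>c \<in> V\<close>] by blast
          hence "W \<inter> W' = {}" using dj W(1) W'(1,2) by (metis disjointD)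
          hence "c \<notin> W'" using W(2) by blast
          hence "x = c'" using W' \<open>c \<in> N x\<close> unfolding leaf_pair_def by blast
          thus ?thesis using centre[OF W'(1,3,4)] x W' by blast
        qed
      qed
      obtain W a b c where W: "W \<in> \<G>" "u \<in> W" "W = {a, b, c}" "leaf_pair N c a b"
        using triple False u(2) by (metis Diff_iff UnionE)
      have swap: "leaf_pair N c b a" "W = {b, a, c}" using W by (auto simp: leaf_pair_def)
      show ?thesis
        using W u centre[OF W(1,3,4)] leaf[OF W(1,3,4)] leaf[OF W(1) swap(2,1)] by blast
    qed
  qed
  hence e1: "poly (pds_poly V N) z = 0 \<longleftrightarrow> (\<exists>B\<in>?B. (1 + z) ^ card B = 1)" for z
    using finG finite_V by (simp add: poly_prod prod_zero_iff)
  \<comment> \<open>A block of size one yields only z = 0, which also satisfies the cubic equation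
    of the triples.\<close>
  have e2: "(\<exists>B\<in>?B. (1 + z) ^ card B = 1) \<longleftrightarrow> (1 + z) ^ 3 = 1" for z :: complex
  proof -
    have "(1 + z) ^ 3 = 1" if "B \<in> ?B" "(1 + z) ^ card B = 1" for B
      using that(1)
    proof
      assume "B \<in> \<G>"
      thus ?thesis using that(2) card3 by simp
    next
      assume "B \<in> (\<lambda>v. {v}) ` ?I"
      hence "card B = 1" by auto
      thus ?thesis using that(2) by simp
    qed
    moreover obtain W where "W \<in> \<G>" using ne by blast
    ultimately show ?thesis using card3[OF \<open>W \<in> \<G>\<close>] by (metis UnI1)
  qed
  have e3: "(1 + z) ^ 3 = 1 \<longleftrightarrow> z \<in> {0, (- 3 + complex_of_real (sqrt 3) * \<i>) / 2,
    (- 3 - complex_of_real (sqrt 3) * \<i>) / 2}" for z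
  proof -
    define r where "r = complex_of_real (sqrt 3) * \<i>"
    have r: "r * r = -3" unfolding r_def by (simp add: complex_eq_iff)
    have "z * (z - (- 3 + r) / 2) * (z - (- 3 - r) / 2) = z * ((2 * z + 3) * (2 * z + 3) - r * r) / 4"
      by (simp add: field_simps)
    also have "\<dots> = (1 + z) ^ 3 - 1"
      unfolding r by (simp add: field_simps power3_eq_cube)
    finally have "(1 + z) ^ 3 = 1 \<longleftrightarrow> z * (z - (- 3 + r) / 2) * (z - (- 3 - r) / 2) = 0" by simp
    thus ?thesis unfolding r_def[symmetric] by simp
  qed
  show ?thesis unfolding e1 e2 e3 by (rule Collect_mem_eq)
qed

end

subsection \<open>The forcing process\<close>

lemma (in pair_graph) nbhd_graph_nbrs: "nbhd_graph (pverts G) (nbrs G)"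
proof
  show "finite (pverts G)" by (rule pair_finite_verts)
  show "nbrs G v \<subseteq> pverts G" if "v \<in> pverts G" for v
    by (auto simp: nbrs_def dest: in_arcsD2)
  show "v \<in> nbrs G u" if "v \<in> pverts G" "u \<in> nbrs G v" for u v
    using that by (auto simp: nbrs_def intro: arcs_symmetric)
  show "v \<notin> nbrs G v" if "v \<in> pverts G" for v
    using pair_no_loops by (fastforce simp: nbrs_def)
qed

context nbhd_graph
begin

text \<open>The uncolored set is disjoint from \<open>C\<close> and therefore no fort. While it is
  nonempty, some colored vertex thus has exactly one neighbour in it and can force.\<close>

lemma force_steps_reach_all:
  assumes "pverts G = V" "nbrs G = N" "C \<subseteq> V" "\<And>U. fort V N U \<Longrightarrow> U \<inter> C \<noteq> {}"
  shows "(force_step G)\<^sup>*\<^sup>* C V"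
  using assms(3,4)
proof (induction "card (V - C)" arbitrary: C rule: less_induct)
  case less
  show ?case
  proof (cases "C = V")
    case False
    have "\<not> fort V N (V - C)" using less.prems(2)[of "V - C"] by blast
    then obtain v where v: "v \<in> V" "v \<in> C" "card (N v \<inter> (V - C)) = 1"
      using False less.prems(1) unfolding fort_def by blast
    then obtain w where w: "N v \<inter> (V - C) = {w}" by (meson card_1_singletonE)
    have "N v - C = {w}" using w N_subset[OF v(1)] by blast
    hence step: "force_step G C (insert w C)"
      using v(2) assms(2) unfolding force_step_def by blast
    have "w \<in> V - C" using w by blast
    hence "card (V - insert w C) < card (V - C)"
      using finite_V by (intro psubset_card_mono) auto
    hence "(force_step G)\<^sup>*\<^sup>* (insert w C) V"
      using less.prems \<open>w \<in> V - C\<close> by (intro less.hyps) blast+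
    with step show ?thesis by (rule converse_rtranclp_into_rtranclp)
  qed simp
qed

text \<open>The first vertex of \<open>U\<close> to be colored would be forced by a vertex outside
  \<open>U\<close> having it as its only neighbour in \<open>U\<close>, which a fort
  excludes.\<close>

lemma force_steps_avoid_fort:
  assumes "pverts G = V" "nbrs G = N" "fort V N U" "(force_step G)\<^sup>*\<^sup>* C D"
    and "C \<subseteq> V" "U \<inter> C = {}"
  shows "D \<subseteq> V \<and> U \<inter> D = {}"
  using assms(4-6)
proof (induction rule: rtranclp_induct)
  case (step D E)
  hence D: "D \<subseteq> V" "U \<inter> D = {}" by blast+
  obtain v w where vw: "v \<in> D" "N v - D = {w}" "E = insert w D"
    using step.hyps(2) assms(2) unfolding force_step_def by blast
  have "w \<notin> U"
  proof
    assume "w \<in> U"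
    hence "N v \<inter> U = {w}" using vw D by blast
    moreover have "v \<in> V - U" using vw D by blast
    hence "card (N v \<inter> U) \<noteq> 1" using assms(3) unfolding fort_def by blast
    ultimately show False by simp
  qed
  moreover have "w \<in> V" using vw D N_subset by blast
  ultimately show ?case using D vw(3) by blast
qed simp

lemma power_dominating_iff_pds:
  assumes "pverts G = V" "nbrs G = N"
  shows "power_dominating G S \<longleftrightarrow> pds V N S"
proof (cases "S \<subseteq> V")
  case True
  let ?C = "S \<union> (\<Union>v\<in>S. N v)"
  have CV: "?C \<subseteq> V" using True N_subset by blast
  \<comment> \<open>By symmetry of adjacency, the first coloring round can be moved from
    \<open>S\<close> to the fort.\<close>
  have meet: "U \<inter> ?C \<noteq> {} \<longleftrightarrow> S \<inter> closed_nbhd N U \<noteq> {}" if "U \<subseteq> V" for U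
    using that True N_sym unfolding closed_nbhd_def by blast
  show ?thesis
  proof
    assume "power_dominating G S"
    hence r: "(force_step G)\<^sup>*\<^sup>* ?C V" using assms unfolding power_dominating_def by simp
    have "S \<inter> closed_nbhd N U \<noteq> {}" if U: "fort V N U" for U
    proof -
      have UV: "U \<subseteq> V" "U \<noteq> {}" using U by (auto simp: fort_def)
      hence "U \<inter> ?C \<noteq> {}" using force_steps_avoid_fort[OF assms U r CV] by blast
      thus ?thesis using meet UV by blast
    qed
    thus "pds V N S" using True unfolding pds_def by blast
  next
    assume S: "pds V N S"
    have "U \<inter> ?C \<noteq> {}" if "fort V N U" for U
    proof -
      have "U \<subseteq> V" using that by (simp add: fort_def)
      moreover have "S \<inter> closed_nbhd N U \<noteq> {}" using S that by (simp add: pds_def)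
      ultimately show ?thesis using meet by blast
    qed
    hence "(force_step G)\<^sup>*\<^sup>* ?C V" using force_steps_reach_all[OF assms CV] by blast
    thus "power_dominating G S" using True assms unfolding power_dominating_def by simp
  qed
next
  case False
  thus ?thesis using assms unfolding power_dominating_def pds_def by simp
qed

end

text \<open>The empty set is not power dominating in a nonempty graph, so starting the sum at
  exponent 1 loses nothing.\<close>

lemma (in pair_graph) power_domination_poly_eq:
  assumes "pverts G \<noteq> {}"
  shows "power_domination_poly G = pds_poly (pverts G) (nbrs G)"
proof -
  interpret nbhd_graph "pverts G" "nbrs G" by (rule nbhd_graph_nbrs)
  have "num_power_dominating G i = card {S. pds (pverts G) (nbrs G) S \<and> card S = i}" for i
    unfolding num_power_dominating_def using power_dominating_iff_pds[of G] by simp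
  hence cf: "of_nat (num_power_dominating G i) = coeff (pds_poly (pverts G) (nbrs G)) i" for i
    by (simp add: coeff_pds_poly[OF finite_V])
  have "coeff (pds_poly (pverts G) (nbrs G)) 0 = 0"
    using poly_pds_poly_0[OF assms] by (simp add: poly_0_coeff_0)
  hence "(\<Sum>i = 1..card (pverts G). monom (coeff (pds_poly (pverts G) (nbrs G)) i) i) =
      (\<Sum>i\<le>card (pverts G). monom (coeff (pds_poly (pverts G) (nbrs G)) i) i)"
    by (intro sum.mono_neutral_left) (auto simp: not_less_eq_eq)
  also have "\<dots> = pds_poly (pverts G) (nbrs G)"
    using poly_as_sum_of_monoms[of "pds_poly (pverts G) (nbrs G)"] by (simp add: degree_pds_poly)
  finally show ?thesis unfolding power_domination_poly_def cf .
qed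

subsection \<open>Isomorphisms\<close>

definition relabel :: "('a \<Rightarrow> 'b) \<Rightarrow> 'a pair_pre_digraph \<Rightarrow> 'b pair_pre_digraph" where
  "relabel f G = \<lparr> pverts = f ` pverts G, parcs = map_prod f f ` parcs G \<rparr>"

definition relabel_iso :: "('a \<Rightarrow> 'b) \<Rightarrow> ('a, 'a \<times> 'a, 'b, 'b \<times> 'b) digraph_isomorphism" where
  "relabel_iso f = \<lparr> iso_verts = f, iso_arcs = map_prod f f, iso_head = snd, iso_tail = fst \<rparr>"

lemma with_proj_relabel: "with_proj (relabel f G) = app_iso (relabel_iso f) (with_proj G)"
  by (simp add: with_proj_def relabel_def relabel_iso_def app_iso_def)

context pair_wf_digraph
begin

lemma parcs_subset: "parcs G \<subseteq> pverts G \<times> pverts G"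
  by (auto dest: in_arcsD1 in_arcsD2)

lemma inj_on_map_prod_parcs: "inj_on f (pverts G) \<Longrightarrow> inj_on (map_prod f f) (parcs G)"
  by (rule inj_on_subset[OF map_prod_inj_on parcs_subset])

lemma digraph_isomorphism_relabel_iso:
  assumes "inj_on f (pverts G)"
  shows "digraph_isomorphism (relabel_iso f)"
  unfolding digraph_isomorphism_def
proof (intro conjI ballI)
  show "wf_digraph (with_proj G)" ..
qed (simp_all add: relabel_iso_def assms inj_on_map_prod_parcs)

text \<open>An isomorphism also carries an arc map. As arcs are pairs on both sides, compatibility
  with head and tail forces it to act componentwise, and only the vertex map remains.\<close>

lemma digraph_iso_relabel_iff:
  "digraph_iso (with_proj G) (with_proj K) \<longleftrightarrow> (\<exists>f. inj_on f (pverts G) \<and> K = relabel f G)"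
proof
  assume "digraph_iso (with_proj G) (with_proj K)"
  then obtain h where h: "digraph_isomorphism h" and K: "with_proj K = app_iso h (with_proj G)"
    unfolding digraph_iso_def by blast
  let ?f = "iso_verts h"
  have ht: "iso_tail h = fst" "iso_head h = snd" and pv: "pverts K = ?f ` pverts G"
    and pa: "parcs K = iso_arcs h ` parcs G"
    using K by (auto simp: with_proj_def app_iso_def)
  have "iso_arcs h e = map_prod ?f ?f e" if "e \<in> parcs G" for e
    using h that unfolding digraph_isomorphism_def ht
    by (metis fst_map_prod prod.expand snd_map_prod)
  hence "parcs K = map_prod ?f ?f ` parcs G" using pa by (auto intro: image_cong)
  hence "K = relabel ?f G" using pv by (simp add: relabel_def)
  moreover have "inj_on ?f (pverts G)" using h unfolding digraph_isomorphism_def by simp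
  ultimately show "\<exists>f. inj_on f (pverts G) \<and> K = relabel f G" by blast
next
  assume "\<exists>f. inj_on f (pverts G) \<and> K = relabel f G"
  thus "digraph_iso (with_proj G) (with_proj K)"
    unfolding digraph_iso_def using digraph_isomorphism_relabel_iso with_proj_relabel by metis
qed

lemma nbrs_relabel:
  assumes "inj_on f (pverts G)" "v \<in> pverts G"
  shows "nbrs (relabel f G) (f v) = f ` nbrs G v"
proof
  show "f ` nbrs G v \<subseteq> nbrs (relabel f G) (f v)"
    by (auto simp: nbrs_def relabel_def intro: rev_image_eqI)
  show "nbrs (relabel f G) (f v) \<subseteq> f ` nbrs G v"
  proof
    fix x assume "x \<in> nbrs (relabel f G) (f v)"
    then obtain u w where uw: "(u, w) \<in> parcs G" "f v = f u" "x = f w"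
      by (auto simp: nbrs_def relabel_def)
    hence "u = v" using inj_onD[OF assms(1)] assms(2) in_arcsD1 by metis
    thus "x \<in> f ` nbrs G v" using uw by (simp add: nbrs_def)
  qed
qed

lemma pair_wf_digraph_relabel: "pair_wf_digraph (relabel f G)"
  using parcs_subset by unfold_locales (auto simp: relabel_def)

lemma relabel_inverse:
  assumes "inj_on f (pverts G)"
  shows "relabel (inv_into (pverts G) f) (relabel f G) = G"
proof -
  let ?g = "inv_into (pverts G) f"
  have "map_prod ?g ?g (map_prod f f e) = e" if "e \<in> parcs G" for e
    using assms arc_fst_in_verts[OF that] arc_snd_in_verts[OF that] by (cases e) simp
  hence "map_prod ?g ?g ` map_prod f f ` parcs G = parcs G"
    by (simp add: image_image)
  moreover have "?g ` f ` pverts G = pverts G"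
    using assms by (simp add: inv_into_image_cancel)
  ultimately show ?thesis by (simp add: relabel_def)
qed

end

section \<open>Leaf partitions of family members and of their disjoint unions\<close>

lemma leaf_pair_image:
  assumes "leaf_pair N c a b" "inj_on g {a, b, c}" "M (g a) = g ` N a" "M (g b) = g ` N b"
  shows "leaf_pair M (g c) (g a) (g b)"
proof -
  have "g a \<noteq> g b" "g a \<noteq> g c" "g b \<noteq> g c"
    using assms(1,2) by (simp_all add: leaf_pair_def inj_on_eq_iff)
  thus ?thesis using assms(1) unfolding leaf_pair_def assms(3,4) by blast
qed

lemma (in pair_wf_digraph) leaf_partition_relabel:
  assumes "leaf_partition (pverts G) (nbrs G) \<G>" "inj_on f (pverts G)"
  shows "leaf_partition (pverts (relabel f G)) (nbrs (relabel f G)) ((`) f ` \<G>)"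
proof -
  have ne: "\<G> \<noteq> {}" and dj: "disjoint \<G>" and sub: "\<Union>\<G> \<subseteq> pverts G"
    and iso: "\<And>v. v \<in> pverts G - \<Union>\<G> \<Longrightarrow> nbrs G v = {}"
    using assms(1) unfolding leaf_partition_def by simp_all
  have triple: "\<exists>a b c. W = {a, b, c} \<and> leaf_pair (nbrs G) c a b" if "W \<in> \<G>" for W
    using assms(1) that unfolding leaf_partition_def by simp
  show ?thesis
    unfolding leaf_partition_def
  proof (intro conjI ballI)
    show "(`) f ` \<G> \<noteq> {}" using ne by simp
    show "disjoint ((`) f ` \<G>)"
    proof (rule disjointI)
      fix A B assume "A \<in> (`) f ` \<G>" "B \<in> (`) f ` \<G>" "A \<noteq> B"
      then obtain X Y where XY: "X \<in> \<G>" "Y \<in> \<G>" "A = f ` X" "B = f ` Y" by blast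
      hence "X \<inter> Y = {}" using dj \<open>A \<noteq> B\<close> by (metis disjointD)
      moreover have "X \<subseteq> pverts G" "Y \<subseteq> pverts G" using sub XY(1,2) by blast+
      ultimately show "A \<inter> B = {}"
        using inj_on_image_Int[OF assms(2)] XY(3,4) by (metis image_empty)
    qed
    show "\<Union> ((`) f ` \<G>) \<subseteq> pverts (relabel f G)" using sub by (auto simp: relabel_def)
  next
    fix W assume "W \<in> (`) f ` \<G>"
    then obtain X where X: "X \<in> \<G>" "W = f ` X" by blast
    obtain a b c where abc: "X = {a, b, c}" "leaf_pair (nbrs G) c a b" using triple[OF X(1)] by blast
    have XG: "X \<subseteq> pverts G" using sub X(1) by blast
    hence "inj_on f {a, b, c}" using inj_on_subset[OF assms(2)] abc(1) by blast
    hence "leaf_pair (nbrs (relabel f G)) (f c) (f a) (f b)"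
      by (rule leaf_pair_image[OF abc(2)]) (use XG abc(1) nbrs_relabel[OF assms(2)] in auto)
    thus "\<exists>a b c. W = {a, b, c} \<and> leaf_pair (nbrs (relabel f G)) c a b"
      using X(2) abc(1) by (intro exI[of _ "f a"] exI[of _ "f b"] exI[of _ "f c"]) simp
  next
    fix x assume x: "x \<in> pverts (relabel f G) - \<Union> ((`) f ` \<G>)"
    then obtain v where v: "v \<in> pverts G" "x = f v" by (auto simp: relabel_def)
    hence "v \<in> pverts G - \<Union>\<G>" using x by blast
    thus "nbrs (relabel f G) x = {}" using iso v nbrs_relabel[OF assms(2)] by simp
  qed
qed

lemma family_F_leaf_partition:
  assumes "G \<in> family_F"
  shows "\<exists>\<G>. leaf_partition (pverts G) (nbrs G) \<G> \<and> \<Union>\<G> = pverts G"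
proof -
  obtain H p q T where H: "pair_graph H" "Digraph_Component.connected (with_proj H)"
    and inj: "inj_on p (pverts H)" "inj_on q (pverts H)"
    and dj: "p ` pverts H \<inter> q ` pverts H = {}" "(p ` pverts H \<union> q ` pverts H) \<inter> pverts H = {}"
    and T: "T \<subseteq> pverts H"
    and G: "G = \<lparr> pverts = pverts H \<union> p ` pverts H \<union> q ` pverts H,
           parcs = parcs H
             \<union> (\<Union>v\<in>pverts H. {(v, p v), (p v, v), (v, q v), (q v, v)})
             \<union> (\<Union>v\<in>T. {(p v, q v), (q v, p v)}) \<rparr>"
    using assms unfolding family_F_def by blast
  interpret H: pair_graph H by (rule H(1))
  \<comment> \<open>Connectedness includes nonemptiness of the vertex set, which provides at least
    one triple.\<close>
  have ne: "pverts H \<noteq> {}" using H(2) by (auto simp: connected_conv)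
  have lp: "leaf_pair (nbrs G) v (p v) (q v)" if v: "v \<in> pverts H" for v
  proof -
    have d: "p v \<notin> pverts H" "q v \<notin> pverts H" "\<And>u. u \<in> pverts H \<Longrightarrow> p v \<noteq> q u"
      "\<And>u. u \<in> pverts H \<Longrightarrow> q v \<noteq> p u" "\<And>u. u \<in> pverts H \<Longrightarrow> p v = p u \<Longrightarrow> u = v"
      "\<And>u. u \<in> pverts H \<Longrightarrow> q v = q u \<Longrightarrow> u = v"
      using v dj inj by (auto dest: inj_onD)
    have TH: "u \<in> pverts H" if "u \<in> T" for u using T that by blast
    have "x \<in> {q v, v}" if "(p v, x) \<in> parcs G" for x
    proof -
      have "(p v, x) \<notin> parcs H" using d(1) H.in_arcsD1 by blast
      thus ?thesis using that d TH unfolding G by fastforce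
    qed
    moreover have "x \<in> {p v, v}" if "(q v, x) \<in> parcs G" for x
    proof -
      have "(q v, x) \<notin> parcs H" using d(2) H.in_arcsD1 by blast
      thus ?thesis using that d TH unfolding G by fastforce
    qed
    ultimately have "nbrs G (p v) \<subseteq> {q v, v}" "nbrs G (q v) \<subseteq> {p v, v}"
      unfolding nbrs_def by blast+
    moreover have "v \<in> nbrs G (p v)" "v \<in> nbrs G (q v)" using v unfolding nbrs_def G by auto
    ultimately show ?thesis using d v unfolding leaf_pair_def by metis
  qed
  let ?W = "\<lambda>v. {p v, q v, v}"
  have "leaf_partition (pverts G) (nbrs G) (?W ` pverts H)"
    unfolding leaf_partition_def
  proof (intro conjI ballI)
    show "?W ` pverts H \<noteq> {}" using ne by simp
    show "disjoint (?W ` pverts H)"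
    proof (rule disjointI)
      fix A B assume "A \<in> ?W ` pverts H" "B \<in> ?W ` pverts H" "A \<noteq> B"
      then obtain u v where uv: "u \<in> pverts H" "v \<in> pverts H" "A = ?W u" "B = ?W v" "u \<noteq> v" by blast
      have "p u \<noteq> p v" "q u \<noteq> q v" using uv inj by (auto dest: inj_onD)
      thus "A \<inter> B = {}" using uv dj by auto
    qed
    show "\<Union> (?W ` pverts H) \<subseteq> pverts G" using G by auto
  next
    fix W assume "W \<in> ?W ` pverts H"
    thus "\<exists>a b c. W = {a, b, c} \<and> leaf_pair (nbrs G) c a b" using lp by blast
  next
    fix v assume "v \<in> pverts G - \<Union> (?W ` pverts H)"
    thus "nbrs G v = {}" using G by auto
  qed
  moreover have "\<Union> (?W ` pverts H) = pverts G" using G by auto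
  ultimately show ?thesis by blast
qed

text \<open>The triples of the summands are taken together; only the vertices of the edgeless part
  stay uncovered, and \<open>k \<ge> 1\<close> supplies a triple.\<close>

lemma disj_union_leaf_partition:
  fixes Gs :: "nat \<Rightarrow> 'a pair_pre_digraph" and k r :: nat
  assumes "k \<ge> 1" "\<And>i. i \<in> {1..k} \<Longrightarrow> Gs i \<in> family_F"
  defines "K \<equiv> disj_union (disj_Union {1..k} Gs) (edgeless r)"
  shows "\<exists>\<G>. leaf_partition (pverts K) (nbrs K) \<G>"
proof -
  have "\<forall>i\<in>{1..k}. \<exists>\<G>. leaf_partition (pverts (Gs i)) (nbrs (Gs i)) \<G> \<and> \<Union>\<G> = pverts (Gs i)"
    using family_F_leaf_partition assms(2) by blast
  from bchoice[OF this] obtain \<G> where \<G>: "\<And>i. i \<in> {1..k} \<Longrightarrow>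
      leaf_partition (pverts (Gs i)) (nbrs (Gs i)) (\<G> i) \<and> \<Union>(\<G> i) = pverts (Gs i)"
    by blast
  let ?e = "\<lambda>i v. Inl (i, v) :: nat \<times> 'a + nat"
  have nb: "nbrs K (?e i v) = ?e i ` nbrs (Gs i) v" if "i \<in> {1..k}" for i v
    using that by (auto simp: nbrs_def K_def disj_union_def disj_Union_def)
  have nbr: "nbrs K (Inr v) = {}" for v
    by (auto simp: nbrs_def K_def disj_union_def edgeless_def)
  let ?G = "\<Union>i\<in>{1..k}. (`) (?e i) ` \<G> i"
  have "leaf_partition (pverts K) (nbrs K) ?G"
    unfolding leaf_partition_def
  proof (intro conjI ballI)
    show "?G \<noteq> {}" using \<G>[of 1] assms(1) by (auto simp: leaf_partition_def)
    show "disjoint ?G"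
    proof (rule disjointI)
      fix A B assume "A \<in> ?G" "B \<in> ?G" "A \<noteq> B"
      then obtain i j X Y where ij: "i \<in> {1..k}" "j \<in> {1..k}" "X \<in> \<G> i" "Y \<in> \<G> j"
        "A = ?e i ` X" "B = ?e j ` Y" by blast
      show "A \<inter> B = {}"
      proof (cases "i = j")
        case True
        hence "X \<inter> Y = {}" using \<G>[OF ij(1)] ij \<open>A \<noteq> B\<close>
          unfolding leaf_partition_def by (metis disjointD)
        thus ?thesis using ij True by auto
      qed (use ij in auto)
    qed
    show "\<Union>?G \<subseteq> pverts K"
    proof
      fix x assume "x \<in> \<Union>?G"
      then obtain i X v where x: "i \<in> {1..k}" "X \<in> \<G> i" "v \<in> X" "x = ?e i v" by blast
      hence "v \<in> pverts (Gs i)" using \<G>[OF x(1)] by blast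
      thus "x \<in> pverts K" using x by (auto simp: K_def disj_union_def disj_Union_def)
    qed
  next
    fix W assume "W \<in> ?G"
    then obtain i X where X: "i \<in> {1..k}" "X \<in> \<G> i" "W = ?e i ` X" by blast
    have "\<forall>W\<in>\<G> i. \<exists>a b c. W = {a, b, c} \<and> leaf_pair (nbrs (Gs i)) c a b"
      using \<G>[OF X(1)] by (simp add: leaf_partition_def)
    then obtain a b c where abc: "X = {a, b, c}" "leaf_pair (nbrs (Gs i)) c a b"
      using X(2) by metis
    have "leaf_pair (nbrs K) (?e i c) (?e i a) (?e i b)"
      using leaf_pair_image[OF abc(2), of "?e i" "nbrs K"] nb[OF X(1)] by (simp add: inj_on_def)
    thus "\<exists>a b c. W = {a, b, c} \<and> leaf_pair (nbrs K) c a b"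
      using X(3) abc(1) by (intro exI[of _ "?e i a"] exI[of _ "?e i b"] exI[of _ "?e i c"]) simp
  next
    fix x assume x: "x \<in> pverts K - \<Union>?G"
    show "nbrs K x = {}"
    proof (cases x)
      case (Inl y)
      then obtain i v where iv: "x = ?e i v" "i \<in> {1..k}" "v \<in> pverts (Gs i)"
        using x by (auto simp: K_def disj_union_def disj_Union_def)
      then obtain X where "X \<in> \<G> i" "v \<in> X" using \<G>[of i] by blast
      hence "x \<in> \<Union>?G" using iv by blast
      thus ?thesis using x by blast
    qed (simp add: nbr)
  qed
  thus ?thesis by blast
qed

section \<open>Recovering family members from a leaf partition\<close>

definition induced :: "'a pair_pre_digraph \<Rightarrow> 'a set \<Rightarrow> 'a pair_pre_digraph" where
  "induced G X = \<lparr> pverts = X, parcs = parcs G \<inter> X \<times> X \<rparr>"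

lemma (in pair_graph) pair_graph_induced:
  assumes "X \<subseteq> pverts G"
  shows "pair_graph (induced G X)"
proof
  show "finite (pverts (induced G X))"
    using finite_subset[OF assms pair_finite_verts] by (simp add: induced_def)
  show "finite (parcs (induced G X))" using pair_finite_arcs by (simp add: induced_def)
  show "symmetric (with_proj (induced G X))"
    unfolding symmetric_def by (rule symI) (auto simp: induced_def intro: arcs_symmetric)
  show "fst e \<noteq> snd e" if "e \<in> parcs (induced G X)" for e
    using that pair_no_loops[of e] by (simp add: induced_def)
qed (auto simp: induced_def)

lemma (in pair_graph) pair_graph_relabel:
  assumes "inj_on f (pverts G)"
  shows "pair_graph (relabel f G)"
proof -
  interpret R: pair_wf_digraph "relabel f G" by (rule pair_wf_digraph_relabel)
  show ?thesis
  proof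
    show "finite (pverts (relabel f G))" using pair_finite_verts by (simp add: relabel_def)
    show "finite (parcs (relabel f G))" using pair_finite_arcs by (simp add: relabel_def)
    show "symmetric (with_proj (relabel f G))"
      unfolding symmetric_def
      by (rule symI) (auto simp: relabel_def intro!: rev_image_eqI[OF arcs_symmetric])
    show "fst e \<noteq> snd e" if "e \<in> parcs (relabel f G)" for e
      using that assms pair_no_loops
      by (fastforce simp: relabel_def dest: inj_onD in_arcsD1 in_arcsD2)
  qed
qed

text \<open>The maps \<open>p\<close> and \<open>q\<close> are conjugated by \<open>f\<close>. This
  carries the parts found inside a graph over to natural-number vertices.\<close>

lemma family_F_relabel:
  assumes "G \<in> family_F" and f: "inj_on f (pverts G)"
  shows "relabel f G \<in> family_F"
proof -
  obtain H p q T where H: "pair_graph H" "Digraph_Component.connected (with_proj H)"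
    and inj: "inj_on p (pverts H)" "inj_on q (pverts H)"
    and dj: "p ` pverts H \<inter> q ` pverts H = {}" "(p ` pverts H \<union> q ` pverts H) \<inter> pverts H = {}"
    and T: "T \<subseteq> pverts H"
    and G: "G = \<lparr> pverts = pverts H \<union> p ` pverts H \<union> q ` pverts H,
           parcs = parcs H
             \<union> (\<Union>v\<in>pverts H. {(v, p v), (p v, v), (v, q v), (q v, v)})
             \<union> (\<Union>v\<in>T. {(p v, q v), (q v, p v)}) \<rparr>"
    using assms unfolding family_F_def by blast
  interpret H: pair_graph H by (rule H(1))
  let ?V = "pverts H"
  have sub: "?V \<subseteq> pverts G" "p ` ?V \<subseteq> pverts G" "q ` ?V \<subseteq> pverts G" using G by auto
  have fH: "inj_on f ?V" using f sub(1) by (rule inj_on_subset)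
  define p' q' where "p' = f \<circ> p \<circ> inv_into ?V f" and "q' = f \<circ> q \<circ> inv_into ?V f"
  have p': "p' (f v) = f (p v)" and q': "q' (f v) = f (q v)" if "v \<in> ?V" for v
    using fH that by (simp_all add: p'_def q'_def)
  have im: "p' ` f ` ?V = f ` p ` ?V" "q' ` f ` ?V = f ` q ` ?V"
    using p' q' by (simp_all add: image_image)
  have "inj_on (p' \<circ> f) ?V"
    using comp_inj_on[OF inj(1) inj_on_subset[OF f sub(2)]] p' by (simp add: inj_on_def)
  hence "inj_on p' (f ` ?V)" by (rule inj_on_imageI)
  have "inj_on (q' \<circ> f) ?V"
    using comp_inj_on[OF inj(2) inj_on_subset[OF f sub(3)]] q' by (simp add: inj_on_def)
  hence "inj_on q' (f ` ?V)" by (rule inj_on_imageI)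
  have I: "f ` A \<inter> f ` B = {}" if "A \<subseteq> pverts G" "B \<subseteq> pverts G" "A \<inter> B = {}" for A B
    using inj_on_image_Int[OF f that(1,2)] that(3) by simp
  have d1: "f ` p ` ?V \<inter> f ` q ` ?V = {}" by (rule I[OF sub(2,3) dj(1)])
  have d2: "(f ` p ` ?V \<union> f ` q ` ?V) \<inter> f ` ?V = {}"
    using I[OF _ sub(1) dj(2)] sub by (simp add: image_Un)
  have arcs: "map_prod f f ` (\<Union>v\<in>?V. {(v, p v), (p v, v), (v, q v), (q v, v)}) =
      (\<Union>v\<in>f ` ?V. {(v, p' v), (p' v, v), (v, q' v), (q' v, v)})"
    using p' q' by (simp add: image_UN)
  have arcsT: "map_prod f f ` (\<Union>v\<in>T. {(p v, q v), (q v, p v)}) =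
      (\<Union>v\<in>f ` T. {(p' v, q' v), (q' v, p' v)})"
    using p' q' subsetD[OF T] by (simp add: image_UN)
  have "relabel f G = \<lparr> pverts = pverts (relabel f H) \<union> p' ` pverts (relabel f H) \<union> q' ` pverts (relabel f H),
           parcs = parcs (relabel f H)
             \<union> (\<Union>v\<in>pverts (relabel f H). {(v, p' v), (p' v, v), (v, q' v), (q' v, v)})
             \<union> (\<Union>v\<in>f ` T. {(p' v, q' v), (q' v, p' v)}) \<rparr>"
    by (simp add: relabel_def G image_Un im arcs arcsT del: UN_simps)
  moreover have "pair_graph (relabel f H)" by (rule H.pair_graph_relabel[OF fH])
  moreover have "Digraph_Component.connected (with_proj (relabel f H))"
    unfolding with_proj_relabel
    by (rule H.connectedI_app_iso[OF H(2) H.digraph_isomorphism_relabel_iso[OF fH]])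
  moreover have pv: "pverts (relabel f H) = f ` ?V" by (simp add: relabel_def)
  have "inj_on p' (pverts (relabel f H))" "inj_on q' (pverts (relabel f H))"
    "p' ` pverts (relabel f H) \<inter> q' ` pverts (relabel f H) = {}"
    "(p' ` pverts (relabel f H) \<union> q' ` pverts (relabel f H)) \<inter> pverts (relabel f H) = {}"
    "f ` T \<subseteq> pverts (relabel f H)"
    unfolding pv im by fact+ (use T in blast)
  ultimately show ?thesis unfolding family_F_def mem_Collect_eq by blast
qed

text \<open>Here \<open>idx\<close> gives the part of a vertex, \<open>\<nu>\<close> its label
  there, and \<open>\<iota>\<close> numbers the isolated vertices. An equality is stated because
  isomorphisms have been reduced to relabellings.\<close>

lemma (in pair_wf_digraph) relabel_disj_union:
  fixes X :: "'i \<Rightarrow> 'a set"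
  assumes V: "pverts G = I \<union> (\<Union>i\<in>J. X i)"
    and idx: "\<And>i v. i \<in> J \<Longrightarrow> v \<in> X i \<Longrightarrow> idx v = i \<and> v \<notin> I"
    and closed: "\<And>i u v. i \<in> J \<Longrightarrow> u \<in> X i \<Longrightarrow> (u, v) \<in> parcs G \<Longrightarrow> v \<in> X i"
    and isolated: "\<And>u v. u \<in> I \<Longrightarrow> (u, v) \<notin> parcs G"
    and \<iota>: "\<iota> ` I = {..<r}"
  shows "disj_union (disj_Union J (\<lambda>i. relabel \<nu> (induced G (X i)))) (edgeless r) =
    relabel (\<lambda>v. if v \<in> I then Inr (\<iota> v) else Inl (idx v, \<nu> v)) G"
    (is "?K = relabel ?\<phi> G")
proof -
  have \<phi>: "?\<phi> v = Inl (i, \<nu> v)" if "i \<in> J" "v \<in> X i" for i v using idx[OF that] by simp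
  have "pverts ?K = Inl ` (SIGMA i:J. \<nu> ` X i) \<union> Inr ` {..<r}"
    by (auto simp: disj_union_def disj_Union_def relabel_def induced_def edgeless_def Plus_def)
  also have "\<dots> = ?\<phi> ` pverts G"
  proof -
    have "?\<phi> ` I = Inr ` \<iota> ` I" by (auto simp: image_image)
    moreover have "?\<phi> ` (\<Union>i\<in>J. X i) = Inl ` (SIGMA i:J. \<nu> ` X i)"
    proof -
      have "?\<phi> ` (\<Union>i\<in>J. X i) = (\<Union>i\<in>J. ?\<phi> ` X i)" by (rule image_UN)
      also have "\<dots> = (\<Union>i\<in>J. (\<lambda>v. Inl (i, \<nu> v)) ` X i)"
        by (intro SUP_cong image_cong refl \<phi>)
      also have "\<dots> = Inl ` (SIGMA i:J. \<nu> ` X i)" by blast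
      finally show ?thesis .
    qed
    ultimately show ?thesis unfolding V image_Un \<iota> by blast
  qed
  finally have pv: "pverts ?K = ?\<phi> ` pverts G" .
  have "parcs ?K = map_prod ?\<phi> ?\<phi> ` parcs G"
  proof (intro set_eqI iffI)
    fix e assume "e \<in> parcs ?K"
    then obtain i u v where iuv: "i \<in> J" "u \<in> X i" "v \<in> X i" "(u, v) \<in> parcs G"
      "e = (Inl (i, \<nu> u), Inl (i, \<nu> v))"
      by (auto simp: disj_union_def disj_Union_def relabel_def induced_def edgeless_def)
    hence "e = map_prod ?\<phi> ?\<phi> (u, v)" using \<phi> by simp
    thus "e \<in> map_prod ?\<phi> ?\<phi> ` parcs G" using iuv(4) by blast
  next
    fix e assume "e \<in> map_prod ?\<phi> ?\<phi> ` parcs G"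
    then obtain u v where uv: "(u, v) \<in> parcs G" "e = (?\<phi> u, ?\<phi> v)" by auto
    hence "u \<in> pverts G" "u \<notin> I" using in_arcsD1 isolated by blast+
    then obtain i where i: "i \<in> J" "u \<in> X i" using V by blast
    hence "v \<in> X i" using closed uv(1) by blast
    hence e: "e = (Inl (i, \<nu> u), Inl (i, \<nu> v))" using uv(2) \<phi> i by simp
    have "(\<nu> u, \<nu> v) \<in> parcs (relabel \<nu> (induced G (X i)))"
      using uv(1) i(2) \<open>v \<in> X i\<close> by (auto simp: relabel_def induced_def intro!: rev_image_eqI)
    thus "e \<in> parcs ?K" using e i(1) by (auto simp: disj_union_def disj_Union_def)
  qed
  with pv show ?thesis
    by (intro pair_pre_digraph.equality) (simp_all add: relabel_def)
qed

context pair_graph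
begin

text \<open>All neighbours of a leaf belong to its own triple, so an edge between different triples
  joins their centres.\<close>

lemma centre_adjacent_cases:
  assumes lp: "\<And>c. c \<in> C \<Longrightarrow> leaf_pair (nbrs G) c (p c) (q c)"
    and dj: "\<And>c d. c \<in> C \<Longrightarrow> d \<in> C \<Longrightarrow> c \<noteq> d \<Longrightarrow> {p c, q c, c} \<inter> {p d, q d, d} = {}"
    and cd: "c \<in> C" "d \<in> C" "u \<in> {p c, q c, c}" "v \<in> {p d, q d, d}" "(u, v) \<in> parcs G" "c \<noteq> d"
  shows "u = c \<and> v = d"
proof -
  have "v \<notin> {p c, q c, c}" "u \<notin> {p d, q d, d}" using dj[OF cd(1,2,6)] cd(3,4) by blast+
  moreover have "v \<in> nbrs G u" "u \<in> nbrs G v" using cd(5) arcs_symmetric by (auto simp: nbrs_def)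
  ultimately show ?thesis
    using lp[OF cd(1)] lp[OF cd(2)] cd(3,4) unfolding leaf_pair_def by blast
qed

text \<open>The connected graph \<open>H\<close> of the family is the one induced on the centres,
  and \<open>?T\<close> records which leaf pairs are adjacent.\<close>

lemma induced_in_family_F:
  assumes lp: "\<And>c. c \<in> D \<Longrightarrow> leaf_pair (nbrs G) c (p c) (q c)"
    and dj: "\<And>c d. c \<in> D \<Longrightarrow> d \<in> D \<Longrightarrow> c \<noteq> d \<Longrightarrow> {p c, q c, c} \<inter> {p d, q d, d} = {}"
    and D: "D \<subseteq> pverts G" "Digraph_Component.connected (with_proj (induced G D))"
  shows "induced G (\<Union>c\<in>D. {p c, q c, c}) \<in> family_F"
proof -
  let ?X = "\<Union>c\<in>D. {p c, q c, c}"
  let ?T = "{c \<in> D. (p c, q c) \<in> parcs G}"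
  have ne: "p c \<noteq> q c" "p c \<noteq> c" "q c \<noteq> c" if "c \<in> D" for c
    using lp[OF that] by (auto simp: leaf_pair_def)
  have nes: "p c \<noteq> p d" "p c \<noteq> q d" "p c \<noteq> d" "q c \<noteq> p d" "q c \<noteq> q d" "q c \<noteq> d"
    if "c \<in> D" "d \<in> D" "c \<noteq> d" for c d
    using dj[OF that] by auto
  have inj: "inj_on p D" "inj_on q D" using nes by (meson inj_onI)+
  have "p c \<noteq> q d" "p c \<noteq> d" "q c \<noteq> d" if "c \<in> D" "d \<in> D" for c d
    using ne nes that by (cases "c = d"; simp)+
  hence d1: "p ` D \<inter> q ` D = {}" and d2: "(p ` D \<union> q ` D) \<inter> D = {}" by blast+
  have arcs_c: "(c, p c) \<in> parcs G" "(p c, c) \<in> parcs G" "(c, q c) \<in> parcs G" "(q c, c) \<in> parcs G"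
    if "c \<in> D" for c
    using lp[OF that] arcs_symmetric unfolding leaf_pair_def nbrs_def by blast+
  have arcs_X: "parcs G \<inter> ?X \<times> ?X = parcs G \<inter> D \<times> D
      \<union> (\<Union>v\<in>D. {(v, p v), (p v, v), (v, q v), (q v, v)}) \<union> (\<Union>v\<in>?T. {(p v, q v), (q v, p v)})"
    (is "?L = ?R")
  proof
    show "?L \<subseteq> ?R"
    proof
      fix e assume "e \<in> ?L"
      then obtain u v c d where uv: "e = (u, v)" "(u, v) \<in> parcs G" "c \<in> D" "d \<in> D"
        "u \<in> {p c, q c, c}" "v \<in> {p d, q d, d}" by (cases e) blast
      show "e \<in> ?R"
      proof (cases "c = d")
        case True
        have "u \<noteq> v" using pair_no_loops[OF uv(2)] by simp
        thus ?thesis using uv True arcs_symmetric[of u v] by blast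
      next
        case False
        hence "u = c" "v = d"
          using centre_adjacent_cases[of D p q c d u v] lp dj uv by blast+
        thus ?thesis using uv by blast
      qed
    qed
    show "?R \<subseteq> ?L" using arcs_c arcs_symmetric by blast
  qed
  have X: "?X = D \<union> p ` D \<union> q ` D" by blast
  have "induced G ?X = \<lparr> pverts = pverts (induced G D) \<union> p ` pverts (induced G D) \<union> q ` pverts (induced G D),
           parcs = parcs (induced G D)
             \<union> (\<Union>v\<in>pverts (induced G D). {(v, p v), (p v, v), (v, q v), (q v, v)})
             \<union> (\<Union>v\<in>?T. {(p v, q v), (q v, p v)}) \<rparr>"
    unfolding induced_def arcs_X pair_pre_digraph.simps by (simp only: X)
  moreover have "pair_graph (induced G D)" by (rule pair_graph_induced[OF D(1)])
  moreover note D(2)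
  moreover have pv: "pverts (induced G D) = D" by (simp add: induced_def)
  have "inj_on p (pverts (induced G D))" "inj_on q (pverts (induced G D))"
    "p ` pverts (induced G D) \<inter> q ` pverts (induced G D) = {}"
    "(p ` pverts (induced G D) \<union> q ` pverts (induced G D)) \<inter> pverts (induced G D) = {}"
    "?T \<subseteq> pverts (induced G D)"
    unfolding pv by fact+ blast
  ultimately show ?thesis unfolding family_F_def mem_Collect_eq by blast
qed

text \<open>Every vertex on a walk from a vertex of \<open>D\<close> inside \<open>C\<close> is
  again in \<open>D\<close>, so the walk survives in the graph induced on \<open>D\<close>.\<close>

lemma connected_induced_component:
  assumes "C \<subseteq> pverts G" "c \<in> C"
  defines "E \<equiv> parcs G \<inter> C \<times> C"
  defines "D \<equiv> E\<^sup>* `` {c}"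
  shows "Digraph_Component.connected (with_proj (induced G D))"
proof -
  have symE: "sym (E\<^sup>*)"
    by (rule sym_rtrancl) (auto simp: sym_def E_def intro: arcs_symmetric)
  let ?r = "symcl (parcs (induced G D))"
  have walk: "v \<in> D \<and> (u, v) \<in> rtrancl_on D ?r" if "u \<in> D" "(u, v) \<in> E\<^sup>*" for u v
    using that(2)
  proof (induction rule: rtrancl_induct)
    case base
    show ?case using that(1) by simp
  next
    case (step y z)
    hence "z \<in> D" unfolding D_def by (meson Image_singleton_iff rtrancl.rtrancl_into_rtrancl)
    moreover have "(y, z) \<in> ?r" using step \<open>z \<in> D\<close> by (auto simp: symcl_def induced_def E_def)
    ultimately show ?case using step by (auto intro: rtrancl_on_into_rtrancl_on)
  qed
  have "(u, v) \<in> E\<^sup>*" if "u \<in> D" "v \<in> D" for u v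
    using that symE unfolding D_def by (meson Image_singleton_iff rtrancl_trans symD)
  hence "\<forall>u\<in>D. \<forall>v\<in>D. (u, v) \<in> rtrancl_on D ?r" using walk by blast
  moreover have "D \<noteq> {}" unfolding D_def by blast
  moreover have pv: "pverts (induced G D) = D" by (simp add: induced_def)
  ultimately show ?thesis unfolding connected_conv with_proj_simps pv by blast
qed

text \<open>A triple need not determine its centre: in a triangle component each vertex qualifies.
  One choice is fixed per triple, and disjointness allows the triples to be indexed by their
  centres.\<close>

lemma leaf_partition_centres:
  assumes "leaf_partition (pverts G) (nbrs G) \<G>"
  obtains C p q where "C \<noteq> {}" "\<And>c. c \<in> C \<Longrightarrow> leaf_pair (nbrs G) c (p c) (q c)"
    "\<And>c d. c \<in> C \<Longrightarrow> d \<in> C \<Longrightarrow> c \<noteq> d \<Longrightarrow> {p c, q c, c} \<inter> {p d, q d, d} = {}"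
    "(\<Union>c\<in>C. {p c, q c, c}) = \<Union>\<G>"
proof -
  have ne: "\<G> \<noteq> {}" and dj: "disjoint \<G>"
    and triple: "\<forall>W\<in>\<G>. \<exists>a b c. W = {a, b, c} \<and> leaf_pair (nbrs G) c a b"
    using assms unfolding leaf_partition_def by simp_all
  obtain \<alpha> \<beta> \<gamma> where abc: "\<And>W. W \<in> \<G> \<Longrightarrow> W = {\<alpha> W, \<beta> W, \<gamma> W} \<and> leaf_pair (nbrs G) (\<gamma> W) (\<alpha> W) (\<beta> W)"
    using triple by metis
  have inj: "inj_on \<gamma> \<G>"
  proof (rule inj_onI)
    fix W W' assume "W \<in> \<G>" "W' \<in> \<G>" "\<gamma> W = \<gamma> W'"
    hence "\<gamma> W \<in> W \<inter> W'" using abc by (metis IntI insertCI)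
    thus "W = W'" using dj \<open>W \<in> \<G>\<close> \<open>W' \<in> \<G>\<close> by (metis disjointD empty_iff)
  qed
  let ?w = "inv_into \<G> \<gamma>"
  have w: "?w c \<in> \<G>" "\<gamma> (?w c) = c" if "c \<in> \<gamma> ` \<G>" for c
    using that by (simp_all add: inv_into_into f_inv_into_f)
  have blk: "?w c = {\<alpha> (?w c), \<beta> (?w c), c}" if "c \<in> \<gamma> ` \<G>" for c
    using abc[OF w(1)[OF that]] w(2)[OF that] by simp
  show ?thesis
  proof (rule that[of "\<gamma> ` \<G>" "\<alpha> \<circ> ?w" "\<beta> \<circ> ?w"])
    show "\<gamma> ` \<G> \<noteq> {}" using ne by simp
    show "leaf_pair (nbrs G) c ((\<alpha> \<circ> ?w) c) ((\<beta> \<circ> ?w) c)" if "c \<in> \<gamma> ` \<G>" for c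
      using abc[OF w(1)[OF that]] w(2)[OF that] by simp
    show "{(\<alpha> \<circ> ?w) c, (\<beta> \<circ> ?w) c, c} \<inter> {(\<alpha> \<circ> ?w) d, (\<beta> \<circ> ?w) d, d} = {}"
      if "c \<in> \<gamma> ` \<G>" "d \<in> \<gamma> ` \<G>" "c \<noteq> d" for c d
    proof -
      have "?w c \<noteq> ?w d" using w(2) that by metis
      hence "?w c \<inter> ?w d = {}" using dj w(1) that by (metis disjointD)
      thus ?thesis using blk[OF that(1)] blk[OF that(2)] by (metis comp_apply)
    qed
    have "(\<Union>c\<in>\<gamma> ` \<G>. {(\<alpha> \<circ> ?w) c, (\<beta> \<circ> ?w) c, c}) = (\<Union>c\<in>\<gamma> ` \<G>. ?w c)"
      using blk by simp
    also have "\<dots> = \<Union>\<G>" using inj by simp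
    finally show "(\<Union>c\<in>\<gamma> ` \<G>. {(\<alpha> \<circ> ?w) c, (\<beta> \<circ> ?w) c, c}) = \<Union>\<G>" .
  qed
qed

text \<open>The graphs \<open>H\<close> are the components of the graph induced on the centres:
  \<open>k\<close> is their number and \<open>r\<close> that of the uncovered vertices.\<close>

theorem leaf_partition_imp_iso:
  assumes "leaf_partition (pverts G) (nbrs G) \<G>"
  shows "\<exists>(k::nat) (r::nat) (Gs :: nat \<Rightarrow> nat pair_pre_digraph).
    k \<ge> 1 \<and> (\<forall>i\<in>{1..k}. Gs i \<in> family_F) \<and>
    digraph_iso (with_proj G) (with_proj (disj_union (disj_Union {1..k} Gs) (edgeless r)))"
proof -
  obtain C p q where ne: "C \<noteq> {}" and lp: "\<And>c. c \<in> C \<Longrightarrow> leaf_pair (nbrs G) c (p c) (q c)"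
    and dj: "\<And>c d. c \<in> C \<Longrightarrow> d \<in> C \<Longrightarrow> c \<noteq> d \<Longrightarrow> {p c, q c, c} \<inter> {p d, q d, d} = {}"
    and U: "(\<Union>c\<in>C. {p c, q c, c}) = \<Union>\<G>"
    using leaf_partition_centres[OF assms] by blast
  have GV: "\<Union>\<G> \<subseteq> pverts G" and iso: "\<And>v. v \<in> pverts G - \<Union>\<G> \<Longrightarrow> nbrs G v = {}"
    using assms unfolding leaf_partition_def by simp_all
  let ?I = "pverts G - \<Union>\<G>"
  let ?b = "\<lambda>c. {p c, q c, c}"
  have CV: "C \<subseteq> pverts G" using U GV by blast
  have finC: "finite C" using finite_subset[OF CV pair_finite_verts] .
  define E where "E = parcs G \<inter> C \<times> C"
  define \<D> where "\<D> = (\<lambda>c. E\<^sup>* `` {c}) ` C"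
  have symE: "sym (E\<^sup>*)"
    by (rule sym_rtrancl) (auto simp: sym_def E_def intro: arcs_symmetric)
  have subC: "D \<subseteq> C" if "D \<in> \<D>" for D
  proof
    fix x assume "x \<in> D"
    then obtain c where "c \<in> C" "(c, x) \<in> E\<^sup>*" using \<open>D \<in> \<D>\<close> unfolding \<D>_def by blast
    thus "x \<in> C" by (auto elim: rtranclE simp: E_def)
  qed
  have closedD: "y \<in> D" if "D \<in> \<D>" "x \<in> D" "(x, y) \<in> E" for D x y
    using that unfolding \<D>_def by (auto intro: rtrancl.rtrancl_into_rtrancl)
  have uniqD: "D = E\<^sup>* `` {x}" if "D \<in> \<D>" "x \<in> D" for D x
  proof -
    obtain c where c: "D = E\<^sup>* `` {c}" using \<open>D \<in> \<D>\<close> unfolding \<D>_def by blast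
    hence "(c, x) \<in> E\<^sup>*" "(x, c) \<in> E\<^sup>*" using that(2) symE by (auto dest: symD)
    thus ?thesis unfolding c by (auto intro: rtrancl_trans)
  qed
  have UD: "\<Union>\<D> = C"
  proof
    show "\<Union>\<D> \<subseteq> C" using subC by blast
    show "C \<subseteq> \<Union>\<D>" unfolding \<D>_def by blast
  qed
  have "finite \<D>" using finC by (simp add: \<D>_def)
  then obtain h where h: "bij_betw h {1..card \<D>} \<D>" using ex_bij_betw_nat_finite_1 by blast
  define k where "k = card \<D>"
  have hD: "h i \<in> \<D>" if "i \<in> {1..k}" for i using h that unfolding k_def by (auto simp: bij_betw_def)
  have k1: "1 \<le> k" using ne \<open>finite \<D>\<close> by (simp add: k_def \<D>_def Suc_le_eq card_gt_0_iff)
  define X where "X i = (\<Union>c\<in>h i. ?b c)" for i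
  have XU: "(\<Union>i\<in>{1..k}. X i) = \<Union>\<G>"
  proof -
    have "(\<Union>i\<in>{1..k}. X i) = (\<Union>D\<in>h ` {1..k}. \<Union>c\<in>D. ?b c)" unfolding X_def by blast
    also have "h ` {1..k} = \<D>" using h unfolding k_def by (simp add: bij_betw_def)
    also have "(\<Union>D\<in>\<D>. \<Union>c\<in>D. ?b c) = (\<Union>c\<in>\<Union>\<D>. ?b c)" by blast
    finally show ?thesis using UD U by simp
  qed
  have Xdj: "i = j" if "i \<in> {1..k}" "j \<in> {1..k}" and v: "v \<in> X i" "v \<in> X j" for i j v
  proof -
    obtain c d where cd: "c \<in> h i" "d \<in> h j" "v \<in> ?b c" "v \<in> ?b d"
      using v unfolding X_def by blast
    have "c \<in> C" "d \<in> C" using cd subC hD that(1,2) by blast+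
    hence "c = d" using dj[of c d] cd(3,4) by blast
    hence "h i = h j" using uniqD[OF hD[OF that(1)] cd(1)] uniqD[OF hD[OF that(2)] cd(2)] by simp
    thus ?thesis using h that(1,2) unfolding k_def bij_betw_def by (meson inj_onD)
  qed
  define idx where "idx v = (THE i. i \<in> {1..k} \<and> v \<in> X i)" for v
  have idx: "idx v = i \<and> v \<notin> ?I" if "i \<in> {1..k}" "v \<in> X i" for i v
  proof
    show "idx v = i" unfolding idx_def using that Xdj by (intro the_equality) blast+
    show "v \<notin> ?I" using that XU by blast
  qed
  \<comment> \<open>An arc leaving a triple joins two centres, which then lie in the same
    component.\<close>
  have closed: "v \<in> X i" if i: "i \<in> {1..k}" and u: "u \<in> X i" and uv: "(u, v) \<in> parcs G" for i u v
  proof -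
    obtain c where c: "c \<in> h i" "u \<in> ?b c" using u unfolding X_def by blast
    have "c \<in> C" using c subC hD[OF i] by blast
    have "v \<in> pverts G" "u \<in> nbrs G v" using in_arcsD2[OF uv] arcs_symmetric[OF uv] by (auto simp: nbrs_def)
    hence "v \<in> \<Union>\<G>" using iso by blast
    then obtain d where d: "d \<in> C" "v \<in> ?b d" using U by blast
    show ?thesis
    proof (cases "c = d")
      case True
      thus ?thesis using c d unfolding X_def by blast
    next
      case False
      hence "u = c \<and> v = d"
        by (intro centre_adjacent_cases[of C p q c d u v] lp dj \<open>c \<in> C\<close> d c(2) uv)
      hence "(c, d) \<in> E" using uv \<open>c \<in> C\<close> d(1) unfolding E_def by blast
      hence "d \<in> h i" using closedD[OF hD[OF i] c(1)] by blast
      thus ?thesis using d(2) unfolding X_def by blast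
    qed
  qed
  \<comment> \<open>One injective numbering of all vertices serves every part at once.\<close>
  obtain \<nu> :: "'a \<Rightarrow> nat" where \<nu>: "inj_on \<nu> (pverts G)"
    using finite_imp_inj_to_nat_seg[OF pair_finite_verts] by blast
  have "finite ?I" using pair_finite_verts by simp
  from finite_imp_inj_to_nat_seg[OF this]
  obtain \<iota> :: "'a \<Rightarrow> nat" and r where \<iota>: "\<iota> ` ?I = {i. i < r}" "inj_on \<iota> ?I"
    by blast
  define Gs where "Gs = (\<lambda>i. relabel \<nu> (induced G (X i)))"
  have "Gs i \<in> family_F" if i: "i \<in> {1..k}" for i
  proof -
    have hC: "h i \<subseteq> C" using subC[OF hD[OF i]] .
    obtain c where c: "c \<in> C" "h i = E\<^sup>* `` {c}" using hD[OF i] unfolding \<D>_def by blast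
    have conn: "Digraph_Component.connected (with_proj (induced G (h i)))"
      using connected_induced_component[OF CV c(1)] unfolding c(2) E_def .
    have "induced G (X i) \<in> family_F"
      unfolding X_def
    proof (rule induced_in_family_F)
      show "leaf_pair (nbrs G) c (p c) (q c)" if "c \<in> h i" for c using lp that hC by blast
      show "?b c \<inter> ?b d = {}" if "c \<in> h i" "d \<in> h i" "c \<noteq> d" for c d
        using that hC by (intro dj) auto
      show "h i \<subseteq> pverts G" using hC CV by blast
    qed (rule conn)
    moreover have "X i \<subseteq> pverts G" using XU GV i by blast
    hence "inj_on \<nu> (pverts (induced G (X i)))"
      using inj_on_subset[OF \<nu>] by (simp add: induced_def)
    ultimately show ?thesis unfolding Gs_def by (rule family_F_relabel)
  qed
  moreover have "digraph_iso (with_proj G) (with_proj (disj_union (disj_Union {1..k} Gs) (edgeless r)))"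
  proof -
    let ?\<phi> = "\<lambda>v. if v \<in> ?I then Inr (\<iota> v) else Inl (idx v, \<nu> v)"
    have "disj_union (disj_Union {1..k} Gs) (edgeless r) = relabel ?\<phi> G"
      unfolding Gs_def
    proof (rule relabel_disj_union)
      show "pverts G = ?I \<union> (\<Union>i\<in>{1..k}. X i)" using XU GV by blast
      show "(u, v) \<notin> parcs G" if "u \<in> ?I" for u v using iso[OF that] by (auto simp: nbrs_def)
      show "\<iota> ` ?I = {..<r}" using \<iota>(1) by auto
    qed (fact idx, fact closed)
    moreover have "inj_on ?\<phi> (pverts G)"
      using \<iota>(2) \<nu> unfolding inj_on_def by (auto split: if_splits)
    ultimately show ?thesis unfolding digraph_iso_relabel_iff by blast
  qed
  ultimately show ?thesis using k1 by blast
qed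

end

theorem theorem33:
  fixes G :: "'a pair_pre_digraph"
  assumes "pair_graph G" and "pverts G \<noteq> {}"
  shows "(card (power_domination_roots G) = 3 \<longleftrightarrow>
           (\<exists>(k::nat) (r::nat) (Gs :: nat \<Rightarrow> nat pair_pre_digraph).
              k \<ge> 1 \<and> (\<forall>i\<in>{1..k}. Gs i \<in> family_F) \<and>
              digraph_iso (with_proj G)
                (with_proj (disj_union (disj_Union {1..k} Gs) (edgeless r)))))
       \<and> (card (power_domination_roots G) = 3 \<longrightarrow>
           power_domination_roots G =
             {0, (- 3 + complex_of_real (sqrt 3) * \<i>) / 2,
                 (- 3 - complex_of_real (sqrt 3) * \<i>) / 2})"
    (is "(?three \<longleftrightarrow> ?iso) \<and> (?three \<longrightarrow> ?roots)")
proof -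
  interpret pair_graph G by (rule assms(1))
  interpret N: nbhd_graph "pverts G" "nbrs G" by (rule nbhd_graph_nbrs)
  let ?part = "\<exists>\<G>. leaf_partition (pverts G) (nbrs G) \<G>"
  have roots: "power_domination_roots G = {z. poly (pds_poly (pverts G) (nbrs G)) z = 0}"
    unfolding power_domination_roots_def power_domination_poly_eq[OF assms(2)] ..
  have three_part: "?three \<Longrightarrow> ?part"
    unfolding roots by (rule N.three_roots_imp_leaf_partition)
  have part_roots: "?part \<Longrightarrow> ?roots"
    unfolding roots using N.leaf_partition_imp_roots by blast
  have roots_three: "?roots \<Longrightarrow> ?three"
    by (simp add: complex_eq_iff)
  have part_iso: "?part \<Longrightarrow> ?iso" using leaf_partition_imp_iso by blast
  have iso_part: ?part if K: ?iso
  proof -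
    obtain k r and Gs :: "nat \<Rightarrow> nat pair_pre_digraph" where k: "k \<ge> 1" "\<forall>i\<in>{1..k}. Gs i \<in> family_F"
      and iso: "digraph_iso (with_proj G) (with_proj (disj_union (disj_Union {1..k} Gs) (edgeless r)))"
      using K by blast
    let ?K = "disj_union (disj_Union {1..k} Gs) (edgeless r)"
    obtain f where f: "inj_on f (pverts G)" "?K = relabel f G"
      using iso unfolding digraph_iso_relabel_iff by blast
    obtain \<G> where \<G>: "leaf_partition (pverts ?K) (nbrs ?K) \<G>"
      using disj_union_leaf_partition[of k Gs r] k by blast
    \<comment> \<open>The leaf partition found in the disjoint union is transported back to
      \<open>G\<close> along the inverse relabelling.\<close>
    have "pair_wf_digraph ?K" unfolding f(2) by (rule pair_wf_digraph_relabel)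
    moreover have "inj_on (inv_into (pverts G) f) (pverts ?K)"
      unfolding f(2) by (simp add: relabel_def inj_on_inv_into)
    ultimately have "leaf_partition (pverts (relabel (inv_into (pverts G) f) ?K))
        (nbrs (relabel (inv_into (pverts G) f) ?K)) ((`) (inv_into (pverts G) f) ` \<G>)"
      using pair_wf_digraph.leaf_partition_relabel \<G> by blast
    thus ?part unfolding f(2) relabel_inverse[OF f(1)] by blast
  qed
  show ?thesis using three_part part_roots roots_three part_iso iso_part by blast
qed

end
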